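(* For all one-free expressions $e,f$ over $X$, $e\equiv f$ if and only if $e\simeq f$.
   Context: Fix a set $X$ of variables. One-free expressions are generated by $e,f::= x \mid 0\mid e+f\mid e\cdot f\mid e\cap f\mid e^+\mid \overline{e}$ ($x\in X$). Semantics: for an alphabet $\Sigma$ and $\sigma:X\to\mathcal P(\Sigma^\star)$, $[\![x]\!]_\sigma=\sigma(x)$, $[\![0]\!]_\sigma=\emptyset$, $+$ union, $\cap$ intersection, $\cdot$ concatenation, $e^+$ is $\bigcup_{n\ge1}[\![e]\!]_\sigma^n$, $\overline e$ the set of reversed words of $[\![e]\!]_\sigma$; $e\simeq f$ iff $[\![e]\!]_\sigma=[\![f]\!]_\sigma$ for all $\Sigma,\sigma$. Here $\equiv$ is the smallest congruence on one-free expressions containing, for all $e,f,g$: $e+f=f+e$; $e+(f+g)=(e+f)+g$; $e+0=e$; $e\cap f=f\cap e$; $e\cap e=e$; $e\cap(f\cap g)=(e\cap f)\cap g$; $(e+f)\cap g=e\cap g+f\cap g$; $(e\cap f)+e=e$; $e\cdot(f\cdot g)=(e\cdot f)\cdot g$; $e\cdot 0=0=0\cdot e$; $(e+f)\cdot g=e\cdot g+f\cdot g$; $e\cdot(f+g)=e\cdot f+e\cdot g$; $e^+=e+e\cdot e^+$; $e^+=e+e^+\cdot e$; $\overline{\overline e}=e$; $\overline{e+f}=\overline e+\overline f$; $\overline{e\cdot f}=\overline f\cdot\overline e$; $\overline{e\cap f}=\overline e\cap\overline f$; $\overline{e^+}=\overline e^{\,+}$; and closed under the rules: if $e\cdot f+f\equiv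 f$ then $e^+\cdot f+f\equiv f$; if $f\cdot e+f\equiv f$ then $f\cdot e^++f\equiv f$. *)

theory Defs
  imports Main
begin

datatype 'x onefree =
    Var 'x
  | Zero
  | Plus "'x onefree" "'x onefree"
  | Conc "'x onefree" "'x onefree"
  | Cap "'x onefree" "'x onefree"
  | Iter "'x onefree"
  | Mirror "'x onefree"

definition conc :: "'a list set \<Rightarrow> 'a list set \<Rightarrow> 'a list set" where
  "conc A B = {u @ v | u v. u \<in> A \<and> v \<in> B}"

primrec lang_power :: "'a list set \<Rightarrow> nat \<Rightarrow> 'a list set" where
  "lang_power A 0 = {[]}"
| "lang_power A (Suc n) = conc A (lang_power A n)"

primrec sem :: "('x \<Rightarrow> 'a list set) \<Rightarrow> 'x onefree \<Rightarrow> 'a list set" where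
  "sem \<sigma> (Var x) = \<sigma> x"
| "sem \<sigma> Zero = {}"
| "sem \<sigma> (Plus e f) = sem \<sigma> e \<union> sem \<sigma> f"
| "sem \<sigma> (Conc e f) = conc (sem \<sigma> e) (sem \<sigma> f)"
| "sem \<sigma> (Cap e f) = sem \<sigma> e \<inter> sem \<sigma> f"
| "sem \<sigma> (Iter e) = (\<Union>n\<in>{1..}. lang_power (sem \<sigma> e) n)"
| "sem \<sigma> (Mirror e) = rev ` sem \<sigma> e"

text \<open>
  The alphabet ranges over all subsets of a universe of letters, given by the type \<open>'a\<close>, because
  HOL cannot quantify over types inside a definition. For alphabets of every finite size to be
  available, the type \<open>'a\<close> has to be infinite.
\<close>

definition lang_equiv :: "'a itself \<Rightarrow> 'x onefree \<Rightarrow> 'x onefree \<Rightarrow> bool" where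
  "lang_equiv _ e f \<longleftrightarrow>
    (\<forall>(\<Sigma> :: 'a set) (\<sigma> :: 'x \<Rightarrow> 'a list set).
      (\<forall>x. \<sigma> x \<subseteq> lists \<Sigma>) \<longrightarrow> sem \<sigma> e = sem \<sigma> f)"

inductive ax_equiv :: "'x onefree \<Rightarrow> 'x onefree \<Rightarrow> bool" (infix "\<equiv>\<^sub>a\<^sub>x" 50) where
  refl: "e \<equiv>\<^sub>a\<^sub>x e"
| sym: "e \<equiv>\<^sub>a\<^sub>x f \<Longrightarrow> f \<equiv>\<^sub>a\<^sub>x e"
| trans: "e \<equiv>\<^sub>a\<^sub>x f \<Longrightarrow> f \<equiv>\<^sub>a\<^sub>x g \<Longrightarrow> e \<equiv>\<^sub>a\<^sub>x g"
| cong_Plus: "e \<equiv>\<^sub>a\<^sub>x e' \<Longrightarrow> f \<equiv>\<^sub>a\<^sub>x f' \<Longrightarrow> Plus e f \<equiv>\<^sub>a\<^sub>x Plus e' f'"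
| cong_Conc: "e \<equiv>\<^sub>a\<^sub>x e' \<Longrightarrow> f \<equiv>\<^sub>a\<^sub>x f' \<Longrightarrow> Conc e f \<equiv>\<^sub>a\<^sub>x Conc e' f'"
| cong_Cap: "e \<equiv>\<^sub>a\<^sub>x e' \<Longrightarrow> f \<equiv>\<^sub>a\<^sub>x f' \<Longrightarrow> Cap e f \<equiv>\<^sub>a\<^sub>x Cap e' f'"
| cong_Iter: "e \<equiv>\<^sub>a\<^sub>x e' \<Longrightarrow> Iter e \<equiv>\<^sub>a\<^sub>x Iter e'"
| cong_Mirror: "e \<equiv>\<^sub>a\<^sub>x e' \<Longrightarrow> Mirror e \<equiv>\<^sub>a\<^sub>x Mirror e'"
| Plus_comm: "Plus e f \<equiv>\<^sub>a\<^sub>x Plus f e"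
| Plus_assoc: "Plus e (Plus f g) \<equiv>\<^sub>a\<^sub>x Plus (Plus e f) g"
| Plus_Zero: "Plus e Zero \<equiv>\<^sub>a\<^sub>x e"
| Cap_comm: "Cap e f \<equiv>\<^sub>a\<^sub>x Cap f e"
| Cap_idem: "Cap e e \<equiv>\<^sub>a\<^sub>x e"
| Cap_assoc: "Cap e (Cap f g) \<equiv>\<^sub>a\<^sub>x Cap (Cap e f) g"
| Cap_distrib: "Cap (Plus e f) g \<equiv>\<^sub>a\<^sub>x Plus (Cap e g) (Cap f g)"
| absorb: "Plus (Cap e f) e \<equiv>\<^sub>a\<^sub>x e"
| Conc_assoc: "Conc e (Conc f g) \<equiv>\<^sub>a\<^sub>x Conc (Conc e f) g"
| Conc_Zero: "Conc e Zero \<equiv>\<^sub>a\<^sub>x Zero"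
| Zero_Conc: "Conc Zero e \<equiv>\<^sub>a\<^sub>x Zero"
| Conc_distrib_right: "Conc (Plus e f) g \<equiv>\<^sub>a\<^sub>x Plus (Conc e g) (Conc f g)"
| Conc_distrib_left: "Conc e (Plus f g) \<equiv>\<^sub>a\<^sub>x Plus (Conc e f) (Conc e g)"
| Iter_unfold_left: "Iter e \<equiv>\<^sub>a\<^sub>x Plus e (Conc e (Iter e))"
| Iter_unfold_right: "Iter e \<equiv>\<^sub>a\<^sub>x Plus e (Conc (Iter e) e)"
| Mirror_Mirror: "Mirror (Mirror e) \<equiv>\<^sub>a\<^sub>x e"
| Mirror_Plus: "Mirror (Plus e f) \<equiv>\<^sub>a\<^sub>x Plus (Mirror e) (Mirror f)"
| Mirror_Conc: "Mirror (Conc e f) \<equiv>\<^sub>a\<^sub>x Conc (Mirror f) (Mirror e)"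
| Mirror_Cap: "Mirror (Cap e f) \<equiv>\<^sub>a\<^sub>x Cap (Mirror e) (Mirror f)"
| Mirror_Iter: "Mirror (Iter e) \<equiv>\<^sub>a\<^sub>x Iter (Mirror e)"
| Iter_induct_left: "Plus (Conc e f) f \<equiv>\<^sub>a\<^sub>x f \<Longrightarrow> Plus (Conc (Iter e) f) f \<equiv>\<^sub>a\<^sub>x f"
| Iter_induct_right: "Plus (Conc f e) f \<equiv>\<^sub>a\<^sub>x f \<Longrightarrow> Plus (Conc f (Iter e)) f \<equiv>\<^sub>a\<^sub>x f"

end

theory Submission
  imports Defs
begin

text \<open>
  An expression stands for a set of series-parallel terms, built from variables and mirrored variables
  by composition and intersection.

  A term \<open>s\<close> can be laid out on a word with pairwise distinct letters, its nodes being positions, in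
  such a way that the word belongs to the language of \<open>f\<close> if and only if some term of \<open>f\<close> maps
  homomorphically to \<open>s\<close>. So language inclusion of \<open>e\<close> in \<open>f\<close> means that every term of \<open>e\<close> is covered
  by \<open>f\<close>.

  To turn this into a proof of \<open>e \<le> f\<close>, every term is assigned a type: a relation between the finitely
  many derivatives of \<open>f\<close>, where \<open>g\<close> is related to \<open>d\<close> if the term followed by \<open>d\<close> is covered by \<open>g\<close>. The
  type of a composition or an intersection is determined by the types of its arguments. By induction on
  \<open>e\<close>, one proves that \<open>e\<close> is below a finite sum of elements \<open>E m\<close>, one for each type \<open>m\<close> of a term of
  \<open>e\<close>, with \<open>E m \<cdot> d \<le> g\<close> for all \<open>(g, d)\<close> in \<open>m\<close>. For an iteration, the elements \<open>E m\<close> are the least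
  solution of a linear system over the semigroup of types. When \<open>f\<close> covers every term of \<open>e\<close>, all the
  \<open>E m\<close> are below \<open>f\<close>.
\<close>

section \<open>One-free Kleene lattices\<close>

text \<open>Mirror is left out: \<open>push_mirror\<close> will move mirrors to the variables, and
  mirrored variables are treated as atoms.\<close>

class onefree_kleene_lattice = semiring_0 + semilattice_inf +
  fixes iter :: "'a \<Rightarrow> 'a"
  assumes le_iff_add_eq: "a \<le> b \<longleftrightarrow> a + b = b"
    and inf_add_distrib: "inf (a + b) c = inf a c + inf b c"
    and iter_unfold_left: "iter a = a + a * iter a"
    and iter_unfold_right: "iter a = a + iter a * a"
    and iter_induct_left: "a * b \<le> b \<Longrightarrow> iter a * b \<le> b"
begin

lemma add_idem: "a + a = a"
  using le_iff_add_eq[of a a] by simp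

subclass canonically_ordered_monoid_add
proof
  fix a b :: 'a
  show "a \<le> b \<longleftrightarrow> (\<exists>c. b = a + c)"
  proof
    show "a \<le> b \<Longrightarrow> \<exists>c. b = a + c"
      unfolding le_iff_add_eq by metis
    show "\<exists>c. b = a + c \<Longrightarrow> a \<le> b"
      unfolding le_iff_add_eq by (metis add.assoc add_idem)
  qed
qed

lemma add_least: "a \<le> c \<Longrightarrow> b \<le> c \<Longrightarrow> a + b \<le> c"
  unfolding le_iff_add_eq by (simp add: add.assoc)

lemma sum_least: "(\<And>i. i \<in> I \<Longrightarrow> f i \<le> c) \<Longrightarrow> sum f I \<le> c"
  by (induction I rule: infinite_finite_induct) (auto intro: add_least)

lemma le_addI1: "a \<le> b \<Longrightarrow> a \<le> b + c"
  unfolding le_iff_add_eq by (metis add.assoc)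

lemma le_addI2: "a \<le> c \<Longrightarrow> a \<le> b + c"
  by (metis le_addI1 add.commute)

lemma le_sumI: "finite I \<Longrightarrow> i \<in> I \<Longrightarrow> a \<le> f i \<Longrightarrow> a \<le> sum f I"
  by (metis le_addI1 sum.remove)

lemma mult_le_mono: "a \<le> b \<Longrightarrow> c \<le> d \<Longrightarrow> a * c \<le> b * d"
proof -
  assume "a \<le> b" "c \<le> d"
  then have "b * d = a * c + (a * d + b * c + b * d)"
    by (metis le_iff_add_eq distrib_left distrib_right add.assoc)
  then show "a * c \<le> b * d"
    using le_iff_add by blast
qed

lemma iter_ge: "a \<le> iter a" and mult_iter_le: "a * iter a \<le> iter a"
  by (subst iter_unfold_left, intro le_addI1 order_refl)
    (subst (2) iter_unfold_left, intro le_addI2 order_refl)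

text \<open>There is no unit to which the induction rule could be applied. Instead, unfolding on the
  right gives \<open>iter a = a + iter a * a\<close>, and
  \<open>iter a * a \<le> iter a * b \<le> b\<close>.\<close>

lemma iter_least: "a \<le> b \<Longrightarrow> a * b \<le> b \<Longrightarrow> iter a \<le> b"
proof -
  assume "a \<le> b" "a * b \<le> b"
  then have "iter a * a \<le> b"
    using iter_induct_left[of a b] mult_le_mono[of "iter a" "iter a" a b] by auto
  with \<open>a \<le> b\<close> show "iter a \<le> b"
    by (subst iter_unfold_right) (rule add_least)
qed

lemma inf_sum_distrib:
  "inf (sum f I) (sum g J) = (\<Sum>i\<in>I. \<Sum>j\<in>J. inf (f i) (g j))"
proof -
  have bot: "inf 0 a = 0" "inf a 0 = 0" for a
    using inf_le1[of 0 a] inf_le2[of a 0] by simp_all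
  have "inf a (sum g J) = (\<Sum>j\<in>J. inf a (g j))" for a
    by (induction J rule: infinite_finite_induct)
      (simp_all add: bot inf_add_distrib inf.commute[of a])
  then show ?thesis
    by (induction I rule: infinite_finite_induct) (simp_all add: bot inf_add_distrib sum.distrib)
qed

text \<open>\<open>None\<close> stands in for the unit that the algebra lacks.\<close>

primrec mult_opt :: "'a \<Rightarrow> 'a option \<Rightarrow> 'a" where
  "mult_opt a None = a"
| "mult_opt a (Some b) = a * b"

lemma mult_opt_mono: "a \<le> b \<Longrightarrow> mult_opt a h \<le> mult_opt b h"
  by (cases h) (auto intro: mult_le_mono)

lemma mult_opt_add: "mult_opt (a + b) h = mult_opt a h + mult_opt b h"
  by (cases h) (simp_all add: distrib_right)

lemma mult_opt_assoc: "mult_opt (a * b) h = a * mult_opt b h"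
  by (cases h) (simp_all add: mult.assoc)

lemma mult_opt_sum: "mult_opt (sum f I) h = (\<Sum>i\<in>I. mult_opt (f i) h)"
  by (cases h) (simp_all add: sum_distrib_right)

text \<open>Gaussian elimination. The leastness is stated up to multiplication on the right by an optional
  element because there are no residuals.\<close>

lemma linear_system_least_solution:
  assumes "finite I"
  shows "\<exists>y. (\<forall>i\<in>I. b i \<le> y i) \<and> (\<forall>i\<in>I. \<forall>j\<in>I. A i j * y j \<le> y i) \<and>
    (\<forall>z h. (\<forall>i\<in>I. mult_opt (b i) h \<le> z i) \<longrightarrow> (\<forall>i\<in>I. \<forall>j\<in>I. A i j * z j \<le> z i) \<longrightarrow>
      (\<forall>i\<in>I. mult_opt (y i) h \<le> z i))"
  using assms
proof (induction I arbitrary: A b rule: finite_induct)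
  case empty
  then show ?case by simp
next
  case (insert k I)
  \<comment> \<open>\<open>s c\<close> is the star of \<open>A k k\<close> applied to
    \<open>c\<close>, written without a unit: the least \<open>z\<close> above \<open>c\<close> with
    \<open>A k k * z \<le> z\<close>. Substituting this solution for the unknown \<open>k\<close>
    into the other rows yields the coefficients \<open>A'\<close> and \<open>b'\<close>.\<close>
  define s where "s c = c + iter (A k k) * c" for c
  define A' where "A' i j = A i j + A i k * s (A k j)" for i j
  define b' where "b' i = b i + A i k * s (b k)" for i
  have s_ge: "c \<le> s c" for c
    unfolding s_def by (rule le_addI1) simp
  have s_mono: "c \<le> d \<Longrightarrow> s c \<le> s d" for c d
    unfolding s_def by (intro add_mono mult_le_mono order_refl)
  have s_closed: "A k k * s c \<le> s c" for c
  proof -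
    have "A k k * s c = (A k k + A k k * iter (A k k)) * c"
      by (simp add: s_def distrib_left distrib_right mult.assoc)
    then show ?thesis
      using iter_unfold_left[of "A k k"] by (simp add: s_def le_addI2)
  qed
  have s_add: "s (c + d) = s c + s d" for c d
    by (simp add: s_def distrib_left ac_simps)
  have s_mult: "s (c * d) = s c * d" for c d
    by (simp add: s_def distrib_right mult.assoc)
  have s_sum: "s (sum f I) = (\<Sum>i\<in>I. s (f i))" for f :: "'b \<Rightarrow> 'a"
    by (simp add: s_def sum.distrib sum_distrib_left)
  have s_least: "s c \<le> z" if "c \<le> z" "A k k * z \<le> z" for c z
    unfolding s_def using that iter_induct_left[of "A k k" z]
      mult_le_mono[of "iter (A k k)" "iter (A k k)" c z] by (auto intro: add_least)
  have s_opt: "mult_opt (s c) h = s (mult_opt c h)" for c h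
    by (simp add: s_def mult_opt_add mult_opt_assoc)
  from insert.IH[of b' A'] obtain y where
    y1: "\<And>i. i \<in> I \<Longrightarrow> b' i \<le> y i" and y2: "\<And>i j. i \<in> I \<Longrightarrow> j \<in> I \<Longrightarrow> A' i j * y j \<le> y i"
    and y3: "\<And>z h i. (\<And>i. i \<in> I \<Longrightarrow> mult_opt (b' i) h \<le> z i) \<Longrightarrow>
      (\<And>i j. i \<in> I \<Longrightarrow> j \<in> I \<Longrightarrow> A' i j * z j \<le> z i) \<Longrightarrow> i \<in> I \<Longrightarrow> mult_opt (y i) h \<le> z i"
    by metis
  \<comment> \<open>Back substitution: \<open>r\<close> is row \<open>k\<close> without its diagonal
    term, so the unknown \<open>k\<close> receives the value \<open>s r\<close>.\<close>
  define r where "r = b k + (\<Sum>j\<in>I. A k j * y j)"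
  define y' where "y' i = (if i = k then s r else y i)" for i
  have yI: "y' i = y i" if "i \<in> I" for i
    using that insert.hyps by (auto simp: y'_def)
  have yk: "y' k = s r" by (simp add: y'_def)
  have Ay: "A i k * s r \<le> y i" if "i \<in> I" for i
  proof -
    have "A i k * s r = A i k * s (b k) + (\<Sum>j\<in>I. A i k * s (A k j) * y j)"
      by (simp add: r_def s_add s_sum s_mult distrib_left sum_distrib_left mult.assoc)
    also have "\<dots> \<le> y i"
    proof (intro add_least sum_least)
      show "A i k * s (b k) \<le> y i"
        using y1[OF that] unfolding b'_def by (metis le_addI2 order_refl order_trans)
      fix j assume "j \<in> I"
      have "A i k * s (A k j) * y j \<le> A' i j * y j"
        unfolding A'_def by (intro mult_le_mono le_addI2 order_refl)
      then show "A i k * s (A k j) * y j \<le> y i"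
        using y2[OF that \<open>j \<in> I\<close>] by simp
    qed
    finally show ?thesis .
  qed
  have "\<forall>i\<in>insert k I. b i \<le> y' i"
  proof
    fix i assume "i \<in> insert k I"
    then show "b i \<le> y' i"
    proof
      assume "i = k"
      then show ?thesis
        using s_ge[of r] yk by (auto simp: r_def intro: order_trans[rotated] le_addI1)
    next
      assume "i \<in> I"
      then show ?thesis
        using y1[of i] yI by (metis b'_def le_addI1 order_refl order_trans)
    qed
  qed
  moreover have "\<forall>i\<in>insert k I. \<forall>j\<in>insert k I. A i j * y' j \<le> y' i"
  proof (intro ballI)
    fix i j assume "i \<in> insert k I" "j \<in> insert k I"
    then consider "i = k" "j = k" | "i = k" "j \<in> I" | "i \<in> I" "j = k" | "i \<in> I" "j \<in> I"
      by auto
    then show "A i j * y' j \<le> y' i"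
    proof cases
      case 1
      then show ?thesis by (simp add: yk s_closed)
    next
      case 2
      have "A k j * y j \<le> r"
        unfolding r_def by (intro le_addI2 le_sumI[OF insert.hyps(1) 2(2)] order_refl)
      then show ?thesis
        using 2 s_ge[of r] by (simp add: yk yI)
    next
      case 3
      then show ?thesis by (simp add: yk yI Ay)
    next
      case 4
      have "A i j * y j \<le> A' i j * y j"
        unfolding A'_def by (intro mult_le_mono le_addI1 order_refl)
      then show ?thesis
        using 4 y2[of i j] by (simp add: yI)
    qed
  qed
  moreover have "mult_opt (y' i) h \<le> z i"
    if z1: "\<forall>i\<in>insert k I. mult_opt (b i) h \<le> z i"
      and z2: "\<forall>i\<in>insert k I. \<forall>j\<in>insert k I. A i j * z j \<le> z i" and i: "i \<in> insert k I" for z h i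
  proof -
    \<comment> \<open>\<open>z k\<close> is closed under \<open>A k k\<close> and therefore absorbs
      \<open>s\<close>. So \<open>z\<close> also solves the reduced system, and the leastness of
      \<open>y\<close> applies to it.\<close>
    have zk: "s c \<le> z k" if "c \<le> z k" for c
      using that z2 by (intro s_least) auto
    have Azk: "A i k * s c \<le> z i" if "c \<le> z k" "i \<in> I" for c i
    proof -
      have "A i k * s c \<le> A i k * z k"
        using zk[OF that(1)] by (intro mult_le_mono) auto
      then show ?thesis
        using z2 that(2) by (meson insertCI order_trans)
    qed
    have zI: "mult_opt (y i) h \<le> z i" if "i \<in> I" for i
      using _ _ that
    proof (rule y3)
      fix i assume "i \<in> I"
      then show "mult_opt (b' i) h \<le> z i"
        using z1 Azk[of "mult_opt (b k) h" i]
        by (auto simp: b'_def mult_opt_add mult_opt_assoc s_opt intro: add_least)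
      fix j assume "j \<in> I"
      then show "A' i j * z j \<le> z i"
        using z2 \<open>i \<in> I\<close> Azk[of "A k j * z j" i]
        by (auto simp: A'_def distrib_right mult.assoc s_mult intro: add_least)
    qed
    have "mult_opt r h \<le> z k"
      unfolding r_def mult_opt_add mult_opt_sum mult_opt_assoc
    proof (intro add_least sum_least)
      show "mult_opt (b k) h \<le> z k" using z1 by simp
      fix j assume "j \<in> I"
      then have "A k j * mult_opt (y j) h \<le> A k j * z j"
        using zI by (intro mult_le_mono) auto
      then show "A k j * mult_opt (y j) h \<le> z k"
        using z2 \<open>j \<in> I\<close> by (meson insertCI order_trans)
    qed
    then show ?thesis
      using zI yI i by (cases "i = k") (auto simp: yk s_opt intro: zk)
  qed
  ultimately show ?case
    by (intro exI[of _ y']) blast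
qed

end


section \<open>The algebra of expressions modulo provable equality\<close>

quotient_type 'x oneclass = "'x onefree" / ax_equiv
  by (intro equivpI reflpI sympI transpI) (auto intro: ax_equiv.intros(1-3))

lift_definition cls :: "'x onefree \<Rightarrow> 'x oneclass" is "\<lambda>e. e" .

lemma cls_eq_iff: "cls e = cls f \<longleftrightarrow> e \<equiv>\<^sub>a\<^sub>x f"
  by transfer simp

text \<open>Absorption with two equal arguments, combined with idempotence of the
  intersection.\<close>

lemma ax_Plus_idem: "Plus e e \<equiv>\<^sub>a\<^sub>x e"
  by (meson ax_equiv.absorb ax_equiv.Cap_idem ax_equiv.cong_Plus ax_equiv.refl ax_equiv.sym ax_equiv.trans)

instantiation oneclass :: (type) onefree_kleene_lattice
begin

lift_definition zero_oneclass :: "'a oneclass" is Zero .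
lift_definition plus_oneclass :: "'a oneclass \<Rightarrow> 'a oneclass \<Rightarrow> 'a oneclass" is Plus
  by (rule ax_equiv.cong_Plus)
lift_definition times_oneclass :: "'a oneclass \<Rightarrow> 'a oneclass \<Rightarrow> 'a oneclass" is Conc
  by (rule ax_equiv.cong_Conc)
lift_definition inf_oneclass :: "'a oneclass \<Rightarrow> 'a oneclass \<Rightarrow> 'a oneclass" is Cap
  by (rule ax_equiv.cong_Cap)
lift_definition iter_oneclass :: "'a oneclass \<Rightarrow> 'a oneclass" is Iter
  by (rule ax_equiv.cong_Iter)
definition less_eq_oneclass :: "'a oneclass \<Rightarrow> 'a oneclass \<Rightarrow> bool" where
  "less_eq_oneclass a b \<longleftrightarrow> a + b = b"
definition less_oneclass :: "'a oneclass \<Rightarrow> 'a oneclass \<Rightarrow> bool" where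
  "less_oneclass a b \<longleftrightarrow> a \<le> b \<and> \<not> b \<le> a"

instance
proof
  fix a b c :: "'a oneclass"
  show add_assoc: "a + b + c = a + (b + c)" for a b c :: "'a oneclass"
    by transfer (rule ax_equiv.sym, rule ax_equiv.Plus_assoc)
  show add_comm: "a + b = b + a" for a b :: "'a oneclass"
    by transfer (rule ax_equiv.Plus_comm)
  show "0 + a = a" for a :: "'a oneclass"
    by (subst add_comm, transfer, rule ax_equiv.Plus_Zero)
  show "a * b * c = a * (b * c)"
    by transfer (rule ax_equiv.sym, rule ax_equiv.Conc_assoc)
  show "(a + b) * c = a * c + b * c"
    by transfer (rule ax_equiv.Conc_distrib_right)
  show "a * (b + c) = a * b + a * c"
    by transfer (rule ax_equiv.Conc_distrib_left)
  show "0 * a = 0" "a * 0 = 0"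
    by (transfer, rule ax_equiv.Zero_Conc, transfer, rule ax_equiv.Conc_Zero)
  have idem: "a + a = a" for a :: "'a oneclass"
    by transfer (rule ax_Plus_idem)
  have inf_comm: "inf a b = inf b a" for a b :: "'a oneclass"
    by transfer (rule ax_equiv.Cap_comm)
  have inf_idem: "inf a a = a" for a :: "'a oneclass"
    by transfer (rule ax_equiv.Cap_idem)
  have inf_assoc: "inf a (inf b c) = inf (inf a b) c" for a b c :: "'a oneclass"
    by transfer (rule ax_equiv.Cap_assoc)
  show distrib: "inf (a + b) c = inf a c + inf b c" for a b c :: "'a oneclass"
    by transfer (rule ax_equiv.Cap_distrib)
  have absorb: "inf a b + a = a" for a b :: "'a oneclass"
    by transfer (rule ax_equiv.absorb)
  \<comment> \<open>The order given by sums is also the order of the meet: if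
    \<open>a + b = b\<close>, then \<open>inf a b = inf a (a + b) = a + inf a b = a\<close>. The
    converse is absorption.\<close>
  have le_inf: "a \<le> b \<longleftrightarrow> inf a b = a" for a b :: "'a oneclass"
    unfolding less_eq_oneclass_def by (metis absorb add_comm distrib inf_comm inf_idem)
  show "a < b \<longleftrightarrow> a \<le> b \<and> \<not> b \<le> a"
    by (rule less_oneclass_def)
  show "a \<le> a"
    by (simp add: less_eq_oneclass_def idem)
  show "a \<le> b \<Longrightarrow> b \<le> c \<Longrightarrow> a \<le> c"
    unfolding less_eq_oneclass_def by (metis add_assoc)
  show "a \<le> b \<Longrightarrow> b \<le> a \<Longrightarrow> a = b"
    unfolding less_eq_oneclass_def by (metis add_comm)
  show "inf a b \<le> a" "inf a b \<le> b"
    unfolding less_eq_oneclass_def by (metis absorb, metis absorb inf_comm)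
  show "a \<le> b \<Longrightarrow> a \<le> c \<Longrightarrow> a \<le> inf b c"
    unfolding le_inf by (simp add: inf_assoc)
  show "a \<le> b \<longleftrightarrow> a + b = b"
    by (rule less_eq_oneclass_def)
  show "iter a = a + a * iter a"
    by transfer (rule ax_equiv.Iter_unfold_left)
  show "iter a = a + iter a * a"
    by transfer (rule ax_equiv.Iter_unfold_right)
  show "a * b \<le> b \<Longrightarrow> iter a * b \<le> b"
    unfolding less_eq_oneclass_def by transfer (rule ax_equiv.Iter_induct_left)
qed

end

lemma cls_simps [simp]:
  "cls Zero = 0" "cls (Plus e f) = cls e + cls f" "cls (Conc e f) = cls e * cls f"
  "cls (Cap e f) = inf (cls e) (cls f)" "cls (Iter e) = iter (cls e)"
  by (transfer, simp add: ax_equiv.refl)+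


section \<open>Series-parallel terms\<close>

text \<open>Atoms carry expressions because an atom is either a variable or a mirrored
  subexpression.\<close>

datatype 'x sp = Atom "'x onefree" | Seq "'x sp" "'x sp" | Par "'x sp" "'x sp"

text \<open>The labels of the edges that lead directly from source to sink. In a composition, an
  inner node separates the two.\<close>

primrec atoms :: "'x sp \<Rightarrow> 'x onefree set" where
  "atoms (Atom a) = {a}"
| "atoms (Seq s t) = {}"
| "atoms (Par s t) = atoms s \<union> atoms t"

text \<open>The pairs in \<open>splits s\<close> correspond to the inner nodes of the series-parallel graph of \<open>s\<close>: they
  are the parts of the graph between the source and the node, and between the node and the sink.\<close>

primrec splits :: "'x sp \<Rightarrow> ('x sp \<times> 'x sp) set" where
  "splits (Atom a) = {}"
| "splits (Seq s t) = {(s, t)} \<union> {(u, Seq v t) | u v. (u, v) \<in> splits s} \<union>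
    {(Seq s u, v) | u v. (u, v) \<in> splits t}"
| "splits (Par s t) = splits s \<union> splits t"

text \<open>\<open>forces s g\<close> means that the graph of some term of \<open>g\<close> has a homomorphism to the graph
  of \<open>s\<close>. Mirrored subexpressions are treated as atoms.\<close>

inductive forces :: "'x sp \<Rightarrow> 'x onefree \<Rightarrow> bool" where
  Var: "Var x \<in> atoms s \<Longrightarrow> forces s (Var x)"
| Mirror: "Mirror g \<in> atoms s \<Longrightarrow> forces s (Mirror g)"
| Plus1: "forces s g \<Longrightarrow> forces s (Plus g h)"
| Plus2: "forces s h \<Longrightarrow> forces s (Plus g h)"
| Cap: "forces s g \<Longrightarrow> forces s h \<Longrightarrow> forces s (Cap g h)"
| Conc: "(u, v) \<in> splits s \<Longrightarrow> forces u g \<Longrightarrow> forces v h \<Longrightarrow> forces s (Conc g h)"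
| Iter1: "forces s g \<Longrightarrow> forces s (Iter g)"
| Iter2: "(u, v) \<in> splits s \<Longrightarrow> forces u g \<Longrightarrow> forces v (Iter g) \<Longrightarrow> forces s (Iter g)"

inductive_set seqs :: "'x sp set \<Rightarrow> 'x sp set" for T where
  single: "s \<in> T \<Longrightarrow> s \<in> seqs T"
| step: "s \<in> T \<Longrightarrow> t \<in> seqs T \<Longrightarrow> Seq s t \<in> seqs T"

primrec terms :: "'x onefree \<Rightarrow> 'x sp set" where
  "terms (Var x) = {Atom (Var x)}"
| "terms Zero = {}"
| "terms (Plus e f) = terms e \<union> terms f"
| "terms (Conc e f) = {Seq s t | s t. s \<in> terms e \<and> t \<in> terms f}"
| "terms (Cap e f) = {Par s t | s t. s \<in> terms e \<and> t \<in> terms f}"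
| "terms (Iter e) = seqs (terms e)"
| "terms (Mirror e) = {Atom (Mirror e)}"

text \<open>A graph embeds into any parallel composition containing it: \<open>atoms\<close> and
  \<open>splits\<close> only grow.\<close>

lemma forces_Par: "forces s g \<Longrightarrow> forces (Par s t) g \<and> forces (Par t s) g"
  by (induction rule: forces.induct) (auto intro: forces.intros)

text \<open>The identity is a homomorphism.\<close>

lemma forces_terms: "s \<in> terms e \<Longrightarrow> forces s e"
proof (induction e arbitrary: s)
  case (Iter e)
  have "s \<in> seqs (terms e) \<Longrightarrow> forces s (Iter e)" for s
    by (induction rule: seqs.induct) (auto intro: forces.Iter1 forces.Iter2 Iter.IH)
  with Iter.prems show ?case by simp
qed (auto intro: forces.intros forces_Par[THEN conjunct1] forces_Par[THEN conjunct2])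


section \<open>Derivatives\<close>

text \<open>What may remain of an expression after a nonempty proper part of it has been matched.
  The two arguments of an intersection start and end at the same nodes, hence either both or none
  of them have been matched completely.\<close>

primrec derivs :: "'x onefree \<Rightarrow> 'x onefree set" where
  "derivs (Var x) = {}"
| "derivs Zero = {}"
| "derivs (Plus g h) = derivs g \<union> derivs h"
| "derivs (Conc g h) = insert h ((\<lambda>d. Conc d h) ` derivs g \<union> derivs h)"
| "derivs (Cap g h) = (\<lambda>(c, d). Cap c d) ` (derivs g \<times> derivs h)"
| "derivs (Iter g) = insert (Iter g) ((\<lambda>d. Conc d (Iter g)) ` derivs g \<union> derivs g)"
| "derivs (Mirror g) = {}"

text \<open>Built to be finite and closed under \<open>derivs\<close> and \<open>components\<close>,
  so that it can serve as the set \<open>F\<close> of the locale below.\<close>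

primrec deriv_closure :: "'x onefree \<Rightarrow> 'x onefree set" where
  "deriv_closure (Var x) = {Var x}"
| "deriv_closure Zero = {Zero}"
| "deriv_closure (Plus g h) = insert (Plus g h) (deriv_closure g \<union> deriv_closure h)"
| "deriv_closure (Conc g h) =
    (\<lambda>d. Conc d h) ` insert g (derivs g) \<union> deriv_closure g \<union> deriv_closure h"
| "deriv_closure (Cap g h) =
    (\<lambda>(c, d). Cap c d) ` (insert g (derivs g) \<times> insert h (derivs h)) \<union>
    deriv_closure g \<union> deriv_closure h"
| "deriv_closure (Iter g) =
    insert (Iter g) ((\<lambda>d. Conc d (Iter g)) ` derivs g) \<union> deriv_closure g"
| "deriv_closure (Mirror g) = {Mirror g}"

lemma finite_derivs: "finite (derivs g)"
  by (induction g) auto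

text \<open>Matching a second part after a first one amounts to matching one longer part. This keeps
  composites of types inside \<open>deriv_rels\<close>.\<close>

lemma derivs_trans: "d \<in> derivs g \<Longrightarrow> derivs d \<subseteq> derivs g"
proof (induction g arbitrary: d)
  case (Plus g h)
  then show ?case by (metis Un_iff derivs.simps(3) le_supI1 le_supI2)
next
  case (Conc g h)
  from Conc.prems consider "d = h" | c where "c \<in> derivs g" "d = Conc c h" | "d \<in> derivs h"
    by auto
  then show ?case
  proof cases
    case 2
    then show ?thesis using Conc.IH(1)[OF 2(1)] by auto
  next
    case 3
    then show ?thesis using Conc.IH(2)[OF 3] by auto
  qed auto
next
  case (Cap g h)
  from Cap.prems obtain b c where bc: "b \<in> derivs g" "c \<in> derivs h" "d = Cap b c"
    by auto
  then show ?case
    using Cap.IH(1)[OF bc(1)] Cap.IH(2)[OF bc(2)] by auto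
next
  case (Iter g)
  from Iter.prems consider "d = Iter g" | c where "c \<in> derivs g" "d = Conc c (Iter g)" | "d \<in> derivs g"
    by auto
  then show ?case
  proof cases
    case 2
    then show ?thesis using Iter.IH[OF 2(1)] by auto
  next
    case 3
    then show ?thesis using Iter.IH[OF 3] by auto
  qed auto
qed simp_all

lemma finite_deriv_closure: "finite (deriv_closure g)"
  by (induction g) (auto simp: finite_derivs)

lemma self_in_deriv_closure: "g \<in> deriv_closure g"
  by (cases g) auto

definition components :: "'x onefree \<Rightarrow> 'x onefree set" where
  "components g = (case g of Plus g h \<Rightarrow> {g, h} | Conc g h \<Rightarrow> {g, h} | Cap g h \<Rightarrow> {g, h}
    | Iter g \<Rightarrow> {g} | _ \<Rightarrow> {})"

lemma components_simps [simp]: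
  "components (Var x) = {}" "components Zero = {}" "components (Plus g h) = {g, h}"
  "components (Conc g h) = {g, h}" "components (Cap g h) = {g, h}" "components (Iter g) = {g}"
  "components (Mirror g) = {}"
  by (simp_all add: components_def)

lemma deriv_closure_closed:
  "g \<in> deriv_closure f \<Longrightarrow> derivs g \<subseteq> deriv_closure f \<and> components g \<subseteq> deriv_closure f"
proof (induction f arbitrary: g)
  case (Plus f1 f2)
  note self = Plus.IH(1)[OF self_in_deriv_closure] Plus.IH(2)[OF self_in_deriv_closure]
    self_in_deriv_closure[of f1] self_in_deriv_closure[of f2]
  from Plus.prems consider "g = Plus f1 f2" | "g \<in> deriv_closure f1" | "g \<in> deriv_closure f2"
    by auto
  then show ?case
  proof cases
    case 1
    then show ?thesis using self by auto
  next
    case 2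
    then show ?thesis using Plus.IH(1)[OF 2] by auto
  next
    case 3
    then show ?thesis using Plus.IH(2)[OF 3] by auto
  qed
next
  case (Conc f1 f2)
  note self = Conc.IH(1)[OF self_in_deriv_closure] Conc.IH(2)[OF self_in_deriv_closure]
    self_in_deriv_closure[of f1] self_in_deriv_closure[of f2]
  from Conc.prems consider d where "d \<in> insert f1 (derivs f1)" "g = Conc d f2"
    | "g \<in> deriv_closure f1" | "g \<in> deriv_closure f2"
    by auto
  then show ?case
  proof cases
    case 1
    then have "derivs d \<subseteq> derivs f1" "d \<in> deriv_closure f1"
      using derivs_trans[of d f1] self by auto
    then show ?thesis using 1(2) self by auto
  next
    case 2
    then show ?thesis using Conc.IH(1)[OF 2] by auto
  next
    case 3
    then show ?thesis using Conc.IH(2)[OF 3] by auto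
  qed
next
  case (Cap f1 f2)
  note self = Cap.IH(1)[OF self_in_deriv_closure] Cap.IH(2)[OF self_in_deriv_closure]
    self_in_deriv_closure[of f1] self_in_deriv_closure[of f2]
  from Cap.prems consider c d where "c \<in> insert f1 (derivs f1)" "d \<in> insert f2 (derivs f2)" "g = Cap c d"
    | "g \<in> deriv_closure f1" | "g \<in> deriv_closure f2"
    by auto
  then show ?case
  proof cases
    case 1
    then have "derivs c \<subseteq> derivs f1" "c \<in> deriv_closure f1" "derivs d \<subseteq> derivs f2" "d \<in> deriv_closure f2"
      using derivs_trans[of c f1] derivs_trans[of d f2] self by auto
    then show ?thesis using 1(3) by auto
  next
    case 2
    then show ?thesis using Cap.IH(1)[OF 2] by auto
  next
    case 3
    then show ?thesis using Cap.IH(2)[OF 3] by auto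
  qed
next
  case (Iter f)
  note self = Iter.IH[OF self_in_deriv_closure] self_in_deriv_closure[of f]
  from Iter.prems consider "g = Iter f" | d where "d \<in> derivs f" "g = Conc d (Iter f)"
    | "g \<in> deriv_closure f"
    by auto
  then show ?case
  proof cases
    case 1
    then show ?thesis using self by auto
  next
    case 2
    then have "derivs d \<subseteq> derivs f" "d \<in> deriv_closure f"
      using derivs_trans[of d f] self by auto
    then show ?thesis using 2(2) self by auto
  next
    case 3
    then show ?thesis using Iter.IH[OF 3] by auto
  qed
qed simp_all


section \<open>Types of series-parallel terms\<close>

text \<open>\<open>F\<close> will be the closure of the right-hand side of the inequation to be
  proved.\<close>

locale deriv_closed =
  fixes F :: "'x onefree set"
  assumes finite_F: "finite F"
    and derivs_F: "g \<in> F \<Longrightarrow> derivs g \<subseteq> F"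
    and components_F: "g \<in> F \<Longrightarrow> components g \<subseteq> F"
begin

text \<open>The type of a term \<open>s\<close> is a relation. A pair \<open>(g, None)\<close> in it says that \<open>s\<close> lies below \<open>g\<close>,
  and \<open>(g, Some d)\<close> says that \<open>s\<close> followed by \<open>d\<close> lies below \<open>g\<close>.\<close>

inductive_set close :: "('x onefree \<times> 'x onefree option) set \<Rightarrow> ('x onefree \<times> 'x onefree option) set"
  for R where
  base: "(g, h) \<in> R \<Longrightarrow> (g, h) \<in> close R"
| Conc1: "(g, None) \<in> close R \<Longrightarrow> Conc g j \<in> F \<Longrightarrow> (Conc g j, Some j) \<in> close R"
| Conc2: "(g, Some d) \<in> close R \<Longrightarrow> Conc g j \<in> F \<Longrightarrow> (Conc g j, Some (Conc d j)) \<in> close R"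
| Plus1: "(g, h) \<in> close R \<Longrightarrow> Plus g j \<in> F \<Longrightarrow> (Plus g j, h) \<in> close R"
| Plus2: "(g, h) \<in> close R \<Longrightarrow> Plus j g \<in> F \<Longrightarrow> (Plus j g, h) \<in> close R"
| Cap1: "(g, None) \<in> close R \<Longrightarrow> (j, None) \<in> close R \<Longrightarrow> Cap g j \<in> F \<Longrightarrow> (Cap g j, None) \<in> close R"
| Cap2: "(g, Some c) \<in> close R \<Longrightarrow> (j, Some d) \<in> close R \<Longrightarrow> Cap g j \<in> F \<Longrightarrow>
    (Cap g j, Some (Cap c d)) \<in> close R"
| Iter1: "(g, h) \<in> close R \<Longrightarrow> Iter g \<in> F \<Longrightarrow> (Iter g, h) \<in> close R"
| Iter2: "(g, None) \<in> close R \<Longrightarrow> Iter g \<in> F \<Longrightarrow> (Iter g, Some (Iter g)) \<in> close R"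
| Iter3: "(g, Some d) \<in> close R \<Longrightarrow> Iter g \<in> F \<Longrightarrow> (Iter g, Some (Conc d (Iter g))) \<in> close R"

text \<open>Relational composition through \<open>Some\<close>: what the first part leaves over is
  what the second part starts from.\<close>

definition comp :: "('x onefree \<times> 'x onefree option) set \<Rightarrow> ('x onefree \<times> 'x onefree option) set \<Rightarrow>
    ('x onefree \<times> 'x onefree option) set" where
  "comp R S = {(g, h). \<exists>k. (g, Some k) \<in> R \<and> (k, h) \<in> S}"

text \<open>\<open>Seq\<close> has no \<open>close\<close> because composites of types are closed
  already, by \<open>close_comp\<close>. Intersecting with \<open>F\<close> keeps all types inside
  the finite set \<open>deriv_rels\<close>.\<close>

primrec sp_type :: "'x sp \<Rightarrow> ('x onefree \<times> 'x onefree option) set" where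
  "sp_type (Atom a) = close ({(a, None)} \<inter> F \<times> UNIV)"
| "sp_type (Seq s t) = comp (sp_type s) (sp_type t)"
| "sp_type (Par s t) = close (sp_type s \<union> sp_type t)"

definition deriv_rels :: "('x onefree \<times> 'x onefree option) set" where
  "deriv_rels = (SIGMA g:F. insert None (Some ` derivs g))"

lemma close_deriv_rels: "R \<subseteq> deriv_rels \<Longrightarrow> close R \<subseteq> deriv_rels"
proof (rule subsetI)
  fix x assume R: "R \<subseteq> deriv_rels" and x: "x \<in> close R"
  obtain g h where "x = (g, h)" by fastforce
  moreover have "(g, h) \<in> deriv_rels" if "(g, h) \<in> close R"
    using that
    by (induction rule: close.induct) (use R in \<open>auto simp: deriv_rels_def\<close>)
  ultimately show "x \<in> deriv_rels" using x by simp
qed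

lemma comp_deriv_rels:
  assumes "R \<subseteq> deriv_rels" "S \<subseteq> deriv_rels"
  shows "comp R S \<subseteq> deriv_rels"
proof (rule subsetI)
  fix x assume "x \<in> comp R S"
  then obtain g h k where x: "x = (g, h)" and "(g, Some k) \<in> R" "(k, h) \<in> S"
    by (auto simp: comp_def)
  then have "g \<in> F" "k \<in> derivs g" "h \<in> insert None (Some ` derivs k)"
    using assms by (auto simp: deriv_rels_def)
  then show "x \<in> deriv_rels"
    using derivs_trans[of k g] x by (auto simp: deriv_rels_def)
qed

lemma sp_type_deriv_rels: "sp_type s \<subseteq> deriv_rels"
proof (induction s)
  case (Atom a)
  then show ?case
    using close_deriv_rels[of "{(a, None)} \<inter> F \<times> UNIV"] by (auto simp: deriv_rels_def)
next
  case (Seq s t)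
  then show ?case using comp_deriv_rels by simp
next
  case (Par s t)
  then show ?case using close_deriv_rels[of "sp_type s \<union> sp_type t"] by simp
qed

text \<open>All types are subsets of one finite set, so even infinitely many terms have only
  finitely many types.\<close>

lemma finite_sp_types: "finite (sp_type ` T)"
proof (rule finite_subset)
  show "sp_type ` T \<subseteq> Pow deriv_rels"
    using sp_type_deriv_rels by blast
  have "finite deriv_rels"
    unfolding deriv_rels_def using finite_F finite_derivs by auto
  then show "finite (Pow deriv_rels)"
    by simp
qed

text \<open>A closing step on a composite pair splits into a step in \<open>R\<close> and, if the
  intermediate expression changes, a step in \<open>S\<close>. By
  \<open>R \<subseteq> deriv_rels\<close> the intermediate expression is a derivative, hence the new
  one stays in \<open>F\<close>.\<close>

lemma close_comp:
  assumes R: "close R \<subseteq> R" "R \<subseteq> deriv_rels" and S: "close S \<subseteq> S"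
  shows "close (comp R S) \<subseteq> comp R S"
proof (rule subsetI)
  have RI: "x \<in> close R \<Longrightarrow> x \<in> R" and SI: "x \<in> close S \<Longrightarrow> x \<in> S" for x
    using R S by auto
  have der: "k \<in> derivs g" if "(g, Some k) \<in> R" for g k
    using that R by (auto simp: deriv_rels_def)
  have ConcF: "Conc k j \<in> F" if "(g, Some k) \<in> R" "Conc g j \<in> F" for g k j
    using derivs_F[OF that(2)] der[OF that(1)] by auto
  have CapF: "Cap k l \<in> F" if "(g, Some k) \<in> R" "(j, Some l) \<in> R" "Cap g j \<in> F" for g k j l
    using derivs_F[OF that(3)] der[OF that(1)] der[OF that(2)] by auto
  have IterF: "Conc k (Iter g) \<in> F" if "(g, Some k) \<in> R" "Iter g \<in> F" for g k
    using derivs_F[OF that(2)] der[OF that(1)] by auto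
  fix x assume x: "x \<in> close (comp R S)"
  obtain g h where gh: "x = (g, h)" by fastforce
  have "\<exists>k. (g, Some k) \<in> R \<and> (k, h) \<in> S" if "(g, h) \<in> close (comp R S)"
    using that
  proof (induction rule: close.induct)
    case (base g h)
    then show ?case by (simp add: comp_def)
  next
    case (Conc1 g j)
    then show ?case using ConcF by (meson RI SI close.base close.Conc1 close.Conc2)
  next
    case (Conc2 g d j)
    then show ?case using ConcF by (meson RI SI close.base close.Conc2)
  next
    case (Plus1 g h j)
    then show ?case by (meson RI close.base close.Plus1)
  next
    case (Plus2 g h j)
    then show ?case by (meson RI close.base close.Plus2)
  next
    case (Cap1 g j)
    then show ?case using CapF by (meson RI SI close.base close.Cap1 close.Cap2)
  next
    case (Cap2 g c j d)
    then show ?case using CapF by (meson RI SI close.base close.Cap2)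
  next
    case (Iter1 g h)
    then show ?case by (meson RI close.base close.Iter1)
  next
    \<comment> \<open>The new intermediate expression is \<open>Conc k (Iter g)\<close>, reached by
      \<open>Iter3\<close> in \<open>R\<close> and left by \<open>Conc1\<close> in
      \<open>S\<close>.\<close>
    case (Iter2 g)
    then show ?case using IterF by (meson RI SI close.base close.Iter3 close.Conc1)
  next
    case (Iter3 g d)
    then show ?case using IterF by (meson RI SI close.base close.Iter3 close.Conc2)
  qed
  then show "x \<in> comp R S"
    using x gh by (simp add: comp_def)
qed

lemma close_close: "close (close R) \<subseteq> close R"
proof (rule subsetI)
  fix x assume x: "x \<in> close (close R)"
  obtain g h where gh: "x = (g, h)" by fastforce
  have "(g, h) \<in> close R" if "(g, h) \<in> close (close R)"
    using that by (induction rule: close.induct) (auto intro: close.intros)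
  with x gh show "x \<in> close R" by simp
qed

lemma close_sp_type: "close (sp_type s) \<subseteq> sp_type s"
  by (induction s) (simp_all add: close_close close_comp sp_type_deriv_rels)

lemma sp_type_closeI: "(g, h) \<in> close (sp_type s) \<Longrightarrow> (g, h) \<in> sp_type s"
  using close_sp_type by blast

text \<open>For \<open>Seq\<close> this is associativity of \<open>comp\<close>; for
  \<open>Par\<close>, the type contains those of both arguments.\<close>

lemma comp_splits: "(u, v) \<in> splits s \<Longrightarrow> comp (sp_type u) (sp_type v) \<subseteq> sp_type s"
proof (induction s arbitrary: u v)
  case (Seq s t)
  from Seq.prems consider "u = s" "v = t"
    | v' where "(u, v') \<in> splits s" "v = Seq v' t" | u' where "(u', v) \<in> splits t" "u = Seq s u'"
    by auto
  then show ?case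
    by cases (use Seq.IH in \<open>fastforce simp: comp_def\<close>)+
next
  case (Par s t)
  then have "comp (sp_type u) (sp_type v) \<subseteq> sp_type s \<union> sp_type t"
    by (metis Un_iff le_supI1 le_supI2 splits.simps(3))
  then show ?case by (auto intro: close.base)
qed simp

lemma atoms_sp_type: "a \<in> atoms s \<Longrightarrow> a \<in> F \<Longrightarrow> (a, None) \<in> sp_type s"
  by (induction s) (auto intro: close.base)

text \<open>The rules of \<open>forces\<close> correspond to closing steps. \<open>Conc\<close> and
  \<open>Iter2\<close> cut the term at an inner node, where \<open>comp_splits\<close> puts the
  types of both parts together.\<close>

lemma forces_sp_type: "forces s g \<Longrightarrow> g \<in> F \<Longrightarrow> (g, None) \<in> sp_type s"
proof (induction rule: forces.induct)
  case (Plus1 s g h)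
  then show ?case
    using components_F[OF Plus1.prems] by (auto intro!: sp_type_closeI close.Plus1[OF close.base])
next
  case (Plus2 s h g)
  then show ?case
    using components_F[OF Plus2.prems] by (auto intro!: sp_type_closeI close.Plus2[OF close.base])
next
  case (Cap s g h)
  then show ?case
    using components_F[OF Cap.prems] by (auto intro!: sp_type_closeI close.Cap1[OF close.base close.base])
next
  case (Conc u v s g h)
  then have "(Conc g h, Some h) \<in> sp_type u" "(h, None) \<in> sp_type v"
    using components_F[OF Conc.prems] by (auto intro!: sp_type_closeI close.Conc1[OF close.base])
  then show ?case
    using comp_splits[OF Conc.hyps(1)] by (auto simp: comp_def)
next
  case (Iter1 s g)
  then show ?case
    using components_F[OF Iter1.prems] by (auto intro!: sp_type_closeI close.Iter1[OF close.base])
next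
  case (Iter2 u v s g)
  then have "(Iter g, Some (Iter g)) \<in> sp_type u" "(Iter g, None) \<in> sp_type v"
    using components_F[OF Iter2.prems] by (auto intro!: sp_type_closeI close.Iter2[OF close.base])
  then show ?case
    using comp_splits[OF Iter2.hyps(1)] by (auto simp: comp_def)
qed (simp_all add: atoms_sp_type)

section \<open>Elements of the algebra that satisfy the inequations of a type\<close>

definition realises :: "'x oneclass \<Rightarrow> ('x onefree \<times> 'x onefree option) set \<Rightarrow> bool" where
  "realises a R \<longleftrightarrow> (\<forall>(g, h) \<in> R. mult_opt a (map_option cls h) \<le> cls g)"

lemma realises_antimono: "a \<le> b \<Longrightarrow> realises b R \<Longrightarrow> realises a R"
  unfolding realises_def
proof clarify
  fix g h assume "a \<le> b" "\<forall>(g, h)\<in>R. mult_opt b (map_option cls h) \<le> cls g" "(g, h) \<in> R"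
  then show "mult_opt a (map_option cls h) \<le> cls g"
    using mult_opt_mono[of a b] by (metis (mono_tags, lifting) case_prodD order_trans)
qed

text \<open>Every rule of \<open>close\<close> is a valid inequation. For \<open>Cap2\<close>,
  \<open>a * inf c d\<close> lies below both \<open>a * c\<close> and \<open>a * d\<close>.\<close>

lemma realises_close:
  assumes "realises a R"
  shows "realises a (close R)"
proof -
  have "mult_opt a (map_option cls h) \<le> cls g" if "(g, h) \<in> close R" for g h
    using that
  proof (induction rule: close.induct)
    case (base g h)
    then show ?case using assms by (auto simp: realises_def)
  next
    case (Iter1 g h)
    then show ?case using iter_ge[of "cls g"] by simp
  next
    case (Iter2 g)
    then have "a * iter (cls g) \<le> cls g * iter (cls g)"
      by (simp add: mult_le_mono)
    then show ?case using mult_iter_le[of "cls g"] by simp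
  next
    case (Iter3 g d)
    then have "a * cls d * iter (cls g) \<le> cls g * iter (cls g)"
      by (simp add: mult_le_mono)
    then show ?case using mult_iter_le[of "cls g"] by (simp add: mult.assoc)
  next
    case (Cap2 g c j d)
    have "a * inf (cls c) (cls d) \<le> a * cls c" "a * inf (cls c) (cls d) \<le> a * cls d"
      by (simp_all add: mult_le_mono)
    then show ?case using Cap2.IH by (auto intro: order_trans)
  qed (auto simp: mult_le_mono le_addI1 le_addI2 simp flip: mult.assoc)
  then show ?thesis by (auto simp: realises_def)
qed

lemma realises_comp:
  assumes "realises a R" "realises b S"
  shows "realises (a * b) (comp R S)"
  unfolding realises_def
proof (clarsimp simp: comp_def mult_opt_assoc)
  fix g h k assume "(g, Some k) \<in> R" "(k, h) \<in> S"
  with assms have "a * cls k \<le> cls g" "mult_opt b (map_option cls h) \<le> cls k"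
    by (auto simp: realises_def)
  then show "a * mult_opt b (map_option cls h) \<le> cls g"
    by (meson mult_le_mono order_refl order_trans)
qed

lemma realises_sum: "(\<And>i. i \<in> I \<Longrightarrow> realises (f i) R) \<Longrightarrow> realises (sum f I) R"
  unfolding realises_def mult_opt_sum by (clarify, rule sum_least) blast

section \<open>Decomposition of expressions along finitely many types\<close>

definition decomposable :: "'x oneclass \<Rightarrow> ('x onefree \<times> 'x onefree option) set set \<Rightarrow> bool" where
  "decomposable a N \<longleftrightarrow> (\<exists>E. a \<le> (\<Sum>m\<in>N. E m) \<and> (\<forall>m\<in>N. realises (E m) m))"

lemma decomposableE:
  assumes "decomposable a N"
  obtains E where "a \<le> sum E N" "\<And>m. m \<in> N \<Longrightarrow> realises (E m) m"
  using assms unfolding decomposable_def by blast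

text \<open>Summands of the same type are added up, which preserves \<open>realises\<close>.\<close>

lemma decomposable_sumI:
  assumes N: "finite N" and J: "finite J"
    and le: "a \<le> sum f J" and f: "\<And>j. j \<in> J \<Longrightarrow> m j \<in> N \<and> realises (f j) (m j)"
  shows "decomposable a N"
proof -
  define E where "E n = (\<Sum>j\<in>{j\<in>J. m j = n}. f j)" for n
  have "sum f J \<le> (\<Sum>n\<in>N. E n)"
  proof (rule sum_least)
    fix j assume j: "j \<in> J"
    have "f j \<le> E (m j)"
      unfolding E_def using j J by (intro le_sumI) auto
    then show "f j \<le> (\<Sum>n\<in>N. E n)"
      using f[OF j] N by (auto intro: le_sumI)
  qed
  moreover have "realises (E n) n" for n
    unfolding E_def using f by (auto intro: realises_sum)
  ultimately show ?thesis
    using le unfolding decomposable_def by (intro exI[of _ E]) auto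
qed

text \<open>The part of \<open>iter a\<close> of type \<open>m\<close> is component \<open>m\<close>
  of the least solution of a linear system: it contains \<open>E m\<close> if
  \<open>m \<in> N\<close>, and a factor of type \<open>l\<close> in front of a rest of type
  \<open>n\<close> contributes to component \<open>comp l n\<close>.\<close>

lemma decomposable_iter:
  assumes N: "finite N" and N': "finite N'" "N \<subseteq> N'" "\<And>m n. m \<in> N \<Longrightarrow> n \<in> N' \<Longrightarrow> comp m n \<in> N'"
    and sub: "\<And>m. m \<in> N' \<Longrightarrow> m \<subseteq> deriv_rels"
    and a: "decomposable a N"
  shows "decomposable (iter a) N'"
proof -
  from a obtain E where E: "a \<le> (\<Sum>m\<in>N. E m)" "\<And>m. m \<in> N \<Longrightarrow> realises (E m) m"
    by (auto simp: decomposable_def)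
  define A where "A m n = (\<Sum>l\<in>{l\<in>N. comp l n = m}. E l)" for m n
  define b where "b m = (if m \<in> N then E m else 0)" for m
  obtain y where y1: "\<And>m. m \<in> N' \<Longrightarrow> b m \<le> y m"
    and y2: "\<And>m n. m \<in> N' \<Longrightarrow> n \<in> N' \<Longrightarrow> A m n * y n \<le> y m"
    and y3: "\<And>z h m. (\<And>m. m \<in> N' \<Longrightarrow> mult_opt (b m) h \<le> z m) \<Longrightarrow>
      (\<And>m n. m \<in> N' \<Longrightarrow> n \<in> N' \<Longrightarrow> A m n * z n \<le> z m) \<Longrightarrow> m \<in> N' \<Longrightarrow> mult_opt (y m) h \<le> z m"
    using linear_system_least_solution[OF N'(1), of b A] by metis
  have "iter a \<le> sum y N'"
  proof (rule iter_least)
    have "sum E N \<le> sum y N'"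
    proof (rule sum_least)
      fix m assume "m \<in> N"
      then show "E m \<le> sum y N'"
        using y1[of m] N' by (intro le_sumI[of _ m]) (auto simp: b_def)
    qed
    then show "a \<le> sum y N'" using E(1) by simp
    \<comment> \<open>The sum of the components absorbs \<open>a\<close> from the left, since
      \<open>E m * y n\<close> falls into component \<open>comp m n\<close>.\<close>
    have "sum E N * sum y N' \<le> sum y N'"
      unfolding sum_product
    proof (intro sum_least)
      fix m n assume mn: "m \<in> N" "n \<in> N'"
      have "E m \<le> A (comp m n) n"
        unfolding A_def using N mn by (intro le_sumI) auto
      then have "E m * y n \<le> A (comp m n) n * y n"
        by (simp add: mult_le_mono)
      also have "\<dots> \<le> y (comp m n)"
        using mn N'(3) by (intro y2) auto
      finally show "E m * y n \<le> sum y N'"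
        using mn N' by (intro le_sumI[of _ "comp m n"]) auto
    qed
    then show "a * sum y N' \<le> sum y N'"
      using mult_le_mono[OF E(1) order_refl[of "sum y N'"]] by simp
  qed
  moreover have "realises (y m) m" if m: "m \<in> N'" for m
    unfolding realises_def
  proof clarify
    fix g h assume gh: "(g, h) \<in> m"
    text \<open>There is no greatest element, so that \<open>T\<close> has to replace the empty meet in \<open>z\<close>.\<close>
    define Q where "Q = sum E N + sum cls F"
    define T where "T = iter Q"
    define Z where "Z n = insert T (cls ` {g. (g, h) \<in> n})" for n
    define z where "z n = Inf_fin (Z n)" for n
    have dom: "{g. (g, h) \<in> n} \<subseteq> F" if "n \<in> N'" for n
      using sub[OF that] by (auto simp: deriv_rels_def)
    have Z: "finite (Z n)" "Z n \<noteq> {}" if "n \<in> N'" for n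
      using finite_subset[OF dom[OF that] finite_F] by (auto simp: Z_def)
    have z_le: "z n \<le> c" if "n \<in> N'" "c \<in> Z n" for n c
      unfolding z_def using that Z by (intro Inf_fin.coboundedI) auto
    have le_z: "c \<le> z n" if "n \<in> N'" "c \<le> T" "\<And>g. (g, h) \<in> n \<Longrightarrow> c \<le> cls g" for n c
      unfolding z_def using that Z by (intro Inf_fin.boundedI) (auto simp: Z_def)
    \<comment> \<open>\<open>Q\<close> bounds every \<open>E l\<close> and, if
      \<open>h = Some d\<close>, also \<open>cls d\<close>. Hence \<open>T\<close> bounds the
      constants multiplied by \<open>h\<close> and absorbs the coefficients from the left.\<close>
    have EQ: "E l \<le> Q" if "l \<in> N" for l
      unfolding Q_def using N that by (intro le_addI1 le_sumI) auto
    have QT: "Q * T \<le> T" "Q \<le> T"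
      unfolding T_def by (rule mult_iter_le, rule iter_ge)
    \<comment> \<open>By leastness it suffices that \<open>z\<close> solves the system with
      constants multiplied by \<open>h\<close>. A pair \<open>(g, h)\<close> in
      \<open>comp l k\<close> passes through some \<open>d\<close> with \<open>(g, Some d)\<close>
      in \<open>l\<close> and \<open>(d, h)\<close> in \<open>k\<close>, so that
      \<open>E l * z k \<le> E l * cls d \<le> cls g\<close>.\<close>
    have "mult_opt (y m) (map_option cls h) \<le> z m"
      using _ _ m
    proof (rule y3)
      fix n assume n: "n \<in> N'"
      show "mult_opt (b n) (map_option cls h) \<le> z n"
      proof (cases "n \<in> N")
        case True
        have "mult_opt (E n) (map_option cls h) \<le> T"
        proof (cases h)
          case None
          then show ?thesis using EQ[OF True] QT by simp
        next
          case (Some d)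
          have "d \<in> F"
            using sub[OF m] gh Some derivs_F by (auto simp: deriv_rels_def)
          then have "cls d \<le> Q"
            unfolding Q_def using finite_F by (intro le_addI2 le_sumI) auto
          then have "E n * cls d \<le> Q * T"
            using EQ[OF True] QT by (intro mult_le_mono) auto
          then show ?thesis using Some QT by simp
        qed
        then show ?thesis
          using E(2)[OF True] True n by (intro le_z) (auto simp: b_def realises_def)
      next
        case False
        then show ?thesis by (cases h) (simp_all add: b_def)
      qed
      fix k assume k: "k \<in> N'"
      show "A n k * z k \<le> z n"
        unfolding A_def sum_distrib_right
      proof (rule sum_least, rule le_z[OF n])
        fix l assume l: "l \<in> {l \<in> N. comp l k = n}"
        have "E l * z k \<le> Q * T"
          using EQ l z_le[OF k, of T] by (intro mult_le_mono) (auto simp: Z_def)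
        then show "E l * z k \<le> T" using QT by simp
        fix g assume "(g, h) \<in> n"
        with l obtain d where d: "(g, Some d) \<in> l" "(d, h) \<in> k"
          by (auto simp: comp_def)
        have "E l * z k \<le> E l * cls d"
          using z_le[OF k, of "cls d"] d by (intro mult_le_mono) (auto simp: Z_def)
        also have "\<dots> \<le> cls g"
          using E(2)[of l] l d by (auto simp: realises_def)
        finally show "E l * z k \<le> cls g" .
      qed
    qed
    also have "\<dots> \<le> cls g"
      using z_le[OF m] gh by (auto simp: Z_def)
    finally show "mult_opt (y m) (map_option cls h) \<le> cls g" .
  qed
  ultimately show ?thesis
    unfolding decomposable_def by blast
qed

text \<open>Products and meets distribute over the decompositions of their arguments, and
  \<open>comp\<close> or \<open>close\<close> gives the type of each resulting summand. Iteration is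
  \<open>decomposable_iter\<close>.\<close>

lemma decomposable_cls: "decomposable (cls e) (sp_type ` terms e)"
proof (induction e)
  case (Var x)
  have "realises (cls (Var x)) (sp_type (Atom (Var x)))"
    unfolding sp_type.simps by (rule realises_close) (simp add: realises_def)
  then show ?case
    unfolding decomposable_def by (intro exI[of _ "\<lambda>_. cls (Var x)"]) simp
next
  case (Mirror e)
  have "realises (cls (Mirror e)) (sp_type (Atom (Mirror e)))"
    unfolding sp_type.simps by (rule realises_close) (simp add: realises_def)
  then show ?case
    unfolding decomposable_def by (intro exI[of _ "\<lambda>_. cls (Mirror e)"]) simp
next
  case Zero
  then show ?case by (simp add: decomposable_def)
next
  case (Plus e f)
  obtain E where
    E: "cls e \<le> sum E (sp_type ` terms e)" "\<And>m. m \<in> sp_type ` terms e \<Longrightarrow> realises (E m) m"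
    using Plus.IH(1) by (rule decomposableE) blast
  obtain E' where
    E': "cls f \<le> sum E' (sp_type ` terms f)" "\<And>m. m \<in> sp_type ` terms f \<Longrightarrow> realises (E' m) m"
    using Plus.IH(2) by (rule decomposableE) blast
  \<comment> \<open>The disjoint sum keeps apart types that occur on both sides;
    \<open>decomposable_sumI\<close> merges their summands.\<close>
  let ?J = "sp_type ` terms e <+> sp_type ` terms f"
  show ?case
  proof (rule decomposable_sumI)
    show "finite ?J" by (simp add: finite_sp_types)
    show "cls (Plus e f) \<le> sum (case_sum E E') ?J"
      using E(1) E'(1) by (simp add: sum.Plus finite_sp_types add_mono)
    show "case_sum id id j \<in> sp_type ` terms (Plus e f) \<and> realises (case_sum E E' j) (case_sum id id j)"
      if "j \<in> ?J" for j
      using that E(2) E'(2) by auto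
  qed (rule finite_sp_types)
next
  case (Conc e f)
  obtain E where
    E: "cls e \<le> sum E (sp_type ` terms e)" "\<And>m. m \<in> sp_type ` terms e \<Longrightarrow> realises (E m) m"
    using Conc.IH(1) by (rule decomposableE) blast
  obtain E' where
    E': "cls f \<le> sum E' (sp_type ` terms f)" "\<And>m. m \<in> sp_type ` terms f \<Longrightarrow> realises (E' m) m"
    using Conc.IH(2) by (rule decomposableE) blast
  let ?J = "sp_type ` terms e \<times> sp_type ` terms f"
  show ?case
  proof (rule decomposable_sumI)
    show "finite ?J" by (simp add: finite_sp_types)
    show "cls (Conc e f) \<le> (\<Sum>(m, n)\<in>?J. E m * E' n)"
      using mult_le_mono[OF E(1) E'(1)] by (simp add: sum_product sum.cartesian_product)
    show "case_prod comp j \<in> sp_type ` terms (Conc e f) \<and>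
        realises (case j of (m, n) \<Rightarrow> E m * E' n) (case_prod comp j)"
      if "j \<in> ?J" for j
    proof -
      from that obtain s t where j: "j = (sp_type s, sp_type t)" "s \<in> terms e" "t \<in> terms f"
        by auto
      then have "Seq s t \<in> terms (Conc e f)" "realises (E (sp_type s) * E' (sp_type t)) (sp_type (Seq s t))"
        by (simp_all add: realises_comp E(2) E'(2))
      then show ?thesis
        unfolding j by (metis case_prod_conv imageI sp_type.simps(2))
    qed
  qed (rule finite_sp_types)
next
  case (Cap e f)
  obtain E where
    E: "cls e \<le> sum E (sp_type ` terms e)" "\<And>m. m \<in> sp_type ` terms e \<Longrightarrow> realises (E m) m"
    using Cap.IH(1) by (rule decomposableE) blast
  obtain E' where
    E': "cls f \<le> sum E' (sp_type ` terms f)" "\<And>m. m \<in> sp_type ` terms f \<Longrightarrow> realises (E' m) m"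
    using Cap.IH(2) by (rule decomposableE) blast
  let ?J = "sp_type ` terms e \<times> sp_type ` terms f"
  show ?case
  proof (rule decomposable_sumI)
    show "finite ?J" by (simp add: finite_sp_types)
    show "cls (Cap e f) \<le> (\<Sum>(m, n)\<in>?J. inf (E m) (E' n))"
      using inf_mono[OF E(1) E'(1)] by (simp add: inf_sum_distrib sum.cartesian_product)
    show "(case j of (m, n) \<Rightarrow> close (m \<union> n)) \<in> sp_type ` terms (Cap e f) \<and>
        realises (case j of (m, n) \<Rightarrow> inf (E m) (E' n)) (case j of (m, n) \<Rightarrow> close (m \<union> n))"
      if "j \<in> ?J" for j
    proof -
      from that obtain s t where j: "j = (sp_type s, sp_type t)" "s \<in> terms e" "t \<in> terms f"
        by auto
      let ?a = "inf (E (sp_type s)) (E' (sp_type t))"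
      have "realises ?a (sp_type s)" "realises ?a (sp_type t)"
        using j realises_antimono[OF inf_le1 E(2)] realises_antimono[OF inf_le2 E'(2)] by auto
      then have "realises ?a (sp_type (Par s t))"
        unfolding sp_type.simps by (intro realises_close) (auto simp: realises_def)
      moreover have "Par s t \<in> terms (Cap e f)"
        using j by simp
      ultimately show ?thesis
        unfolding j by (metis case_prod_conv imageI sp_type.simps(3))
    qed
  qed (rule finite_sp_types)
next
  case (Iter e)
  have "decomposable (iter (cls e)) (sp_type ` seqs (terms e))"
  proof (rule decomposable_iter[OF finite_sp_types finite_sp_types _ _ _ Iter.IH])
    show "sp_type ` terms e \<subseteq> sp_type ` seqs (terms e)"
      by (auto intro: seqs.single)
    fix m n assume "m \<in> sp_type ` terms e" "n \<in> sp_type ` seqs (terms e)"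
    then obtain s t where "s \<in> terms e" "t \<in> seqs (terms e)" "m = sp_type s" "n = sp_type t"
      by blast
    then show "comp m n \<in> sp_type ` seqs (terms e)"
      using seqs.step[of s _ t] by (metis imageI sp_type.simps(2))
  next
    show "m \<subseteq> deriv_rels" if "m \<in> sp_type ` seqs (terms e)" for m
      using that sp_type_deriv_rels by (metis imageE)
  qed
  then show ?case by simp
qed

end

text \<open>With \<open>F\<close> the closure of \<open>f\<close>, the type of every term of
  \<open>e\<close> contains \<open>(f, None)\<close>, which puts each summand of the decomposition
  of \<open>e\<close> below \<open>f\<close>.\<close>

theorem forces_complete:
  assumes "\<And>s. s \<in> terms e \<Longrightarrow> forces s f"
  shows "cls e \<le> cls f"
proof -
  interpret deriv_closed "deriv_closure f"
    by unfold_locales (simp_all add: finite_deriv_closure deriv_closure_closed)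
  obtain E where E: "cls e \<le> sum E (sp_type ` terms e)"
    "\<And>m. m \<in> sp_type ` terms e \<Longrightarrow> realises (E m) m"
    using decomposable_cls[of e] unfolding decomposable_def by blast
  have "E m \<le> cls f" if "m \<in> sp_type ` terms e" for m
  proof -
    from that obtain s where "s \<in> terms e" "m = sp_type s" by blast
    then have "(f, None) \<in> m"
      using assms forces_sp_type self_in_deriv_closure by blast
    then show ?thesis
      using E(2)[OF that] by (auto simp: realises_def)
  qed
  then show ?thesis
    using E(1) by (meson sum_least order_trans)
qed


section \<open>Laying out series-parallel terms on words\<close>

text \<open>A triple \<open>(p, c, q)\<close> stands for the factor of the word between the positions \<open>p\<close> and \<open>q\<close>, and
  \<open>c\<close> is the part of the graph of \<open>s\<close> between the corresponding nodes. Factors have length at least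
  two so that they differ from their mirror images.\<close>

definition is_layout :: "(nat \<times> 'x sp \<times> nat) set \<Rightarrow> nat \<Rightarrow> 'x sp \<Rightarrow> bool" where
  "is_layout G n s \<longleftrightarrow> (0, s, n) \<in> G \<and>
    (\<forall>p c q. (p, c, q) \<in> G \<longrightarrow> p + 2 \<le> q \<and> q \<le> n) \<and>
    (\<forall>p c d q. (p, c, q) \<in> G \<longrightarrow> (p, d, q) \<in> G \<longrightarrow> c = d) \<and>
    (\<forall>p a k b q. (p, a, k) \<in> G \<longrightarrow> (k, b, q) \<in> G \<longrightarrow> (\<exists>c. (p, c, q) \<in> G \<and> (a, b) \<in> splits c)) \<and>
    (\<forall>p c q a b. (p, c, q) \<in> G \<longrightarrow> (a, b) \<in> splits c \<longrightarrow> (\<exists>k. (p, a, k) \<in> G \<and> (k, b, q) \<in> G))"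

lemma is_layoutD:
  assumes "is_layout G n s"
  shows "(0, s, n) \<in> G"
    and "(p, c, q) \<in> G \<Longrightarrow> p + 2 \<le> q"
    and "(p, c, q) \<in> G \<Longrightarrow> q \<le> n"
    and "(p, c, q) \<in> G \<Longrightarrow> (p, d, q) \<in> G \<Longrightarrow> c = d"
    and "(p, a, k) \<in> G \<Longrightarrow> (k, b, q) \<in> G \<Longrightarrow> \<exists>c. (p, c, q) \<in> G \<and> (a, b) \<in> splits c"
    and "(p, c, q) \<in> G \<Longrightarrow> (a, b) \<in> splits c \<Longrightarrow> \<exists>k. (p, a, k) \<in> G \<and> (k, b, q) \<in> G"
  using assms unfolding is_layout_def by blast+

text \<open>The word of the second graph follows that of the first, shifted by \<open>m\<close>. A
  factor across position \<open>m\<close> composes a part that reaches the first sink with a part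
  that leaves the second source.\<close>

inductive_set seq_layout :: "(nat \<times> 'x sp \<times> nat) set \<Rightarrow> nat \<Rightarrow> (nat \<times> 'x sp \<times> nat) set \<Rightarrow>
    (nat \<times> 'x sp \<times> nat) set" for G m H where
  left: "(p, a, q) \<in> G \<Longrightarrow> (p, a, q) \<in> seq_layout G m H"
| right: "(p, a, q) \<in> H \<Longrightarrow> (m + p, a, m + q) \<in> seq_layout G m H"
| across: "(p, a, m) \<in> G \<Longrightarrow> (0, b, q) \<in> H \<Longrightarrow> (p, Seq a b, m + q) \<in> seq_layout G m H"

text \<open>The first graph has its sink moved from \<open>m\<close> to \<open>m + n\<close>, the
  second its source from \<open>m\<close> to \<open>0\<close>. Inner nodes of the first lie before
  \<open>m\<close>, those of the second after it, so they never meet. The full factors of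
  \<open>s\<close> and \<open>t\<close> are replaced by that of \<open>Par s t\<close>.\<close>

inductive_set par_layout :: "(nat \<times> 'x sp \<times> nat) set \<Rightarrow> nat \<Rightarrow> 'x sp \<Rightarrow>
    (nat \<times> 'x sp \<times> nat) set \<Rightarrow> nat \<Rightarrow> 'x sp \<Rightarrow> (nat \<times> 'x sp \<times> nat) set" for G m s H n t where
  whole: "(0, Par s t, m + n) \<in> par_layout G m s H n t"
| left: "(p, a, q) \<in> G \<Longrightarrow> p \<noteq> 0 \<or> q \<noteq> m \<Longrightarrow>
    (p, a, if q = m then m + n else q) \<in> par_layout G m s H n t"
| right: "(p, a, q) \<in> H \<Longrightarrow> p \<noteq> 0 \<or> q \<noteq> n \<Longrightarrow>
    (if p = 0 then 0 else m + p, a, m + q) \<in> par_layout G m s H n t"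

text \<open>Factors are nonempty, so comparing their ends with \<open>m\<close> tells the three
  kinds apart.\<close>

lemma is_layout_seq:
  assumes G: "is_layout G m s" and H: "is_layout H n t"
  shows "is_layout (seq_layout G m H) (m + n) (Seq s t)"
proof -
  note GD = is_layoutD[OF G] and HD = is_layoutD[OF H]
  note intros = seq_layout.left[where G = G and H = H] seq_layout.right[where G = G and H = H]
    seq_layout.across[where G = G and H = H]
  have bounds: "p + 2 \<le> q \<and> q \<le> m + n" if "(p, c, q) \<in> seq_layout G m H" for p c q
    using that
  proof cases
    case left
    then show ?thesis using GD(2,3)[of p c q] by simp
  next
    case (right p' q')
    then show ?thesis using HD(2,3)[of p' c q'] by simp
  next
    case (across a b q')
    then show ?thesis using HD(2,3)[of 0 b q'] GD(2)[of p a m] by simp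
  qed
  have unique: "c = d" if "(p, c, q) \<in> seq_layout G m H" "(p, d, q) \<in> seq_layout G m H" for p c d q
    using that(1)
  proof cases
    case left
    note l = this
    from that(2) show ?thesis
    proof cases
      case left
      then show ?thesis using l GD(4) by blast
    next
      case (right p' q')
      then show ?thesis using GD(2,3)[OF l] HD(2)[OF right(3)] by simp
    next
      case (across a b q')
      then show ?thesis using GD(3)[OF l] HD(2)[OF across(4)] by simp
    qed
  next
    case (right p' q')
    note r = this
    from that(2) show ?thesis
    proof cases
      case left
      then show ?thesis using GD(2,3)[OF left] HD(2)[OF r(3)] r by simp
    next
      case (right p'' q'')
      then show ?thesis using r HD(4) by simp
    next
      case (across a b q')
      then show ?thesis using GD(2)[OF across(3)] r by simp
    qed
  next
    case (across a b q')
    note x = this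
    from that(2) show ?thesis
    proof cases
      case left
      then show ?thesis using GD(3)[OF left] HD(2)[OF x(4)] x by simp
    next
      case (right p'' q'')
      then show ?thesis using GD(2)[OF x(3)] by simp
    next
      case (across a' b' q'')
      then show ?thesis using x GD(4)[OF x(3)] HD(4)[OF x(4)] by simp
    qed
  qed
  have join: "\<exists>c. (p, c, q) \<in> seq_layout G m H \<and> (a, b) \<in> splits c"
    if 1: "(p, a, k) \<in> seq_layout G m H" and 2: "(k, b, q) \<in> seq_layout G m H" for p a k b q
    using 1
  proof cases
    case left
    note l = this
    from 2 show ?thesis
    proof cases
      case left
      then show ?thesis using GD(5)[OF l left] intros(1) by blast
    next
      case (right p' q')
      \<comment> \<open>A node that ends a left factor and starts a right one can only be the
        junction.\<close>
      have "k = m" "p' = 0" using GD(3)[OF l] right by auto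
      then show ?thesis using intros(3)[of p a m b q'] l right
        by (intro exI[of _ "Seq a b"]) simp
    next
      case (across c d q')
      from GD(5)[OF l across(3)] obtain e where "(p, e, m) \<in> G" "(a, c) \<in> splits e"
        by blast
      then show ?thesis using intros(3)[of p e m d q'] across
        by (intro exI[of _ "Seq e d"]) simp
    qed
  next
    case (right p' k')
    note r = this
    from 2 show ?thesis
    proof cases
      case left
      then show ?thesis using GD(2,3)[OF left] r by simp
    next
      case (right p'' q')
      then have "(k', b, q') \<in> H" using r by simp
      from HD(5)[OF r(3) this] obtain c where "(p', c, q') \<in> H" "(a, b) \<in> splits c"
        by blast
      then show ?thesis using intros(2)[of p' c q'] r right by auto
    next
      case (across c d q')
      then show ?thesis using GD(2)[OF across(3)] r by simp
    qed
  next
    case (across c d k')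
    note x = this
    from 2 show ?thesis
    proof cases
      case left
      then show ?thesis using GD(2,3)[OF left] x by simp
    next
      case (right p'' q')
      then have "(k', b, q') \<in> H" using x by simp
      from HD(5)[OF x(4) this] obtain e where "(0, e, q') \<in> H" "(d, b) \<in> splits e"
        by blast
      then show ?thesis using intros(3)[OF x(3), of e q'] x right
        by (intro exI[of _ "Seq c e"]) simp
    next
      case (across c' d' q')
      then show ?thesis using GD(2)[OF across(3)] x by simp
    qed
  qed
  have split: "\<exists>k. (p, a, k) \<in> seq_layout G m H \<and> (k, b, q) \<in> seq_layout G m H"
    if 1: "(p, c, q) \<in> seq_layout G m H" and 2: "(a, b) \<in> splits c" for p c q a b
    using 1
  proof cases
    case left
    then show ?thesis using GD(6)[OF left 2] intros(1) by blast
  next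
    case (right p' q')
    from HD(6)[OF right(3) 2] obtain k where "(p', a, k) \<in> H" "(k, b, q') \<in> H"
      by blast
    then show ?thesis using intros(2)[of p' a k] intros(2)[of k b q'] right by blast
  next
    case (across d e q')
    from 2 across(1) consider "a = d" "b = e"
      | v where "(a, v) \<in> splits d" "b = Seq v e" | u where "(u, b) \<in> splits e" "a = Seq d u"
      by auto
    then show ?thesis
    proof cases
      case 1
      then show ?thesis using across intros(1)[OF across(3)] intros(2)[OF across(4)] by auto
    next
      case 2
      then obtain k where "(p, a, k) \<in> G" "(k, v, m) \<in> G"
        using GD(6)[OF across(3)] by blast
      then show ?thesis using intros(1)[of p a k] intros(3)[of k v m e q'] across 2 by blast
    next
      case 3
      then obtain k where "(0, u, k) \<in> H" "(k, b, q') \<in> H"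
        using HD(6)[OF across(4)] by blast
      then show ?thesis using intros(3)[OF across(3), of u k] intros(2)[of k b q'] across 3 by blast
    qed
  qed
  have "(0, Seq s t, m + n) \<in> seq_layout G m H"
    using GD(1) HD(1) by (rule intros(3))
  with bounds unique join split show ?thesis
    unfolding is_layout_def by blast
qed

lemma is_layout_par:
  assumes G: "is_layout G m s" and H: "is_layout H n t"
  shows "is_layout (par_layout G m s H n t) (m + n) (Par s t)"
proof -
  let ?P = "par_layout G m s H n t"
  note GD = is_layoutD[OF G] and HD = is_layoutD[OF H]
  note whole = par_layout.whole[where G = G and m = m and s = s and H = H and n = n and t = t]
  have mn: "m \<ge> 2" "n \<ge> 2"
    using GD(2)[OF GD(1)] HD(2)[OF HD(1)] by simp_all
  have left_inner: "(p, a, q) \<in> ?P" if "(p, a, q) \<in> G" "q < m" for p a q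
    using par_layout.left[OF that(1), of m n s H t] that(2) by simp
  have left_end: "(p, a, m + n) \<in> ?P" if "(p, a, m) \<in> G" "p \<noteq> 0" for p a
    using par_layout.left[OF that(1), of m n s H t] that(2) by simp
  have right_inner: "(m + p, a, m + q) \<in> ?P" if "(p, a, q) \<in> H" "p \<noteq> 0" for p a q
    using par_layout.right[OF that(1), of n m G s t] that(2) by simp
  have right_start: "(0, a, m + q) \<in> ?P" if "(0, a, q) \<in> H" "q \<noteq> n" for a q
    using par_layout.right[OF that(1), of n m G s t] that(2) by simp
  \<comment> \<open>Factors sorted by which of their ends has been moved, with bounds that reduce
    the clashes between kinds to arithmetic.\<close>
  have cases: thesis
    if "(p, c, q) \<in> ?P"
      and "p = 0 \<Longrightarrow> c = Par s t \<Longrightarrow> q = m + n \<Longrightarrow> thesis"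
      and "(p, c, q) \<in> G \<Longrightarrow> q < m \<Longrightarrow> p + 2 \<le> q \<Longrightarrow> thesis"
      and "(p, c, m) \<in> G \<Longrightarrow> p \<noteq> 0 \<Longrightarrow> q = m + n \<Longrightarrow> p + 2 \<le> m \<Longrightarrow> thesis"
      and "\<And>q'. p = 0 \<Longrightarrow> q = m + q' \<Longrightarrow> (0, c, q') \<in> H \<Longrightarrow> q' < n \<Longrightarrow> 2 \<le> q' \<Longrightarrow> thesis"
      and "\<And>p' q'. p = m + p' \<Longrightarrow> q = m + q' \<Longrightarrow> (p', c, q') \<in> H \<Longrightarrow> p' \<noteq> 0 \<Longrightarrow> p' + 2 \<le> q' \<Longrightarrow>
        q' \<le> n \<Longrightarrow> thesis"
    for p c q thesis
    using that(1)
  proof cases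
    case whole
    then show ?thesis using that(2) by simp
  next
    case (left q')
    then show ?thesis
      using that(3,4) GD(2)[OF left(2)] GD(3)[OF left(2)] by (cases "q' = m") auto
  next
    case (right p' q')
    then show ?thesis
      using that(5)[of q'] that(6)[of p' q'] HD(2)[OF right(3)] HD(3)[OF right(3)]
      by (cases "p' = 0") auto
  qed
  have bounds: "p + 2 \<le> q \<and> q \<le> m + n" if "(p, c, q) \<in> ?P" for p c q
    using that by (rule cases) (use mn in auto)
  have unique: "c = d" if 1: "(p, c, q) \<in> ?P" and 2: "(p, d, q) \<in> ?P" for p c d q
    by (rule cases[OF 1]; rule cases[OF 2]) (use mn in \<open>auto dest: GD(4) HD(4)\<close>)
  have join: "\<exists>c. (p, c, q) \<in> ?P \<and> (a, b) \<in> splits c"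
    if 1: "(p, a, k) \<in> ?P" and 2: "(k, b, q) \<in> ?P" for p a k b q
  proof -
    have L: "\<exists>c. (p, c, if q = m then m + n else q) \<in> ?P \<and> (a, b) \<in> splits c"
      if "(p, a, k) \<in> G" "(k, b, q) \<in> G" for q
    proof -
      obtain c where c: "(p, c, q) \<in> G" "(a, b) \<in> splits c"
        using GD(5) \<open>(p, a, k) \<in> G\<close> \<open>(k, b, q) \<in> G\<close> by blast
      show ?thesis
      \<comment> \<open>If the joined factor is all of \<open>s\<close>, then \<open>Par s t\<close>
        takes its place, as it has all the splits of \<open>s\<close>.\<close>
      proof (cases "p = 0 \<and> q = m")
        case True
        with c GD(1) GD(4) have "c = s" by blast
        with c True whole show ?thesis by (intro exI[of _ "Par s t"]) simp
      next
        case False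
        then show ?thesis by (intro exI[of _ c] conjI par_layout.left c) simp
      qed
    qed
    have R: "\<exists>c. (if p = 0 then 0 else m + p, c, m + q) \<in> ?P \<and> (a, b) \<in> splits c"
      if "(p, a, k) \<in> H" "(k, b, q) \<in> H" for p k q
    proof -
      obtain c where c: "(p, c, q) \<in> H" "(a, b) \<in> splits c"
        using HD(5) \<open>(p, a, k) \<in> H\<close> \<open>(k, b, q) \<in> H\<close> by blast
      show ?thesis
      proof (cases "p = 0 \<and> q = n")
        case True
        with c HD(1) HD(4) have "c = t" by blast
        with c True whole show ?thesis by (intro exI[of _ "Par s t"]) simp
      next
        case False
        then show ?thesis by (intro exI[of _ c] conjI par_layout.right c) simp
      qed
    qed
    show ?thesis
      using 1
    proof (rule cases)
      assume l: "(p, a, k) \<in> G" "k < m" "p + 2 \<le> k"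
      show ?thesis
        using 2 by (rule cases) (use l L[OF l(1), of q] L[OF l(1), of m] in auto)
    next
      fix k' assume r: "p = 0" "k = m + k'" "(0, a, k') \<in> H" "k' < n" "2 \<le> k'"
      show ?thesis
        using 2 by (rule cases) (use r R[OF r(3)] in auto)
    next
      fix p' k' assume r: "p = m + p'" "k = m + k'" "(p', a, k') \<in> H" "p' \<noteq> 0" "p' + 2 \<le> k'" "k' \<le> n"
      show ?thesis
        using 2 by (rule cases) (use r R[OF r(3)] in auto)
    \<comment> \<open>In the remaining cases the first factor ends at \<open>m + n\<close>, where no
      factor starts.\<close>
    qed (use bounds[OF 2] in auto)
  qed
  have split: "\<exists>k. (p, a, k) \<in> ?P \<and> (k, b, q) \<in> ?P"
    if 1: "(p, c, q) \<in> ?P" and 2: "(a, b) \<in> splits c" for p c q a b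
    using 1
  proof (rule cases)
    assume w: "p = 0" "c = Par s t" "q = m + n"
    with 2 consider "(a, b) \<in> splits s" | "(a, b) \<in> splits t" by auto
    then show ?thesis
    proof cases
      case 1
      then obtain k where k: "(0, a, k) \<in> G" "(k, b, m) \<in> G" using GD(6)[OF GD(1)] by blast
      then have "k < m" "k \<noteq> 0" using GD(2)[OF k(1)] GD(2)[OF k(2)] by auto
      then show ?thesis using w k left_inner left_end by blast
    next
      case 2
      then obtain k where k: "(0, a, k) \<in> H" "(k, b, n) \<in> H" using HD(6)[OF HD(1)] by blast
      then have "k \<noteq> n" "k \<noteq> 0" using HD(2)[OF k(1)] HD(2)[OF k(2)] by auto
      then show ?thesis using w k right_inner right_start by blast
    qed
  next
    assume l: "(p, c, q) \<in> G" "q < m"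
    then obtain k where k: "(p, a, k) \<in> G" "(k, b, q) \<in> G" using GD(6) 2 by blast
    then have "k < m" using GD(2)[OF k(2)] l by auto
    then show ?thesis using k l left_inner by blast
  next
    assume l: "(p, c, m) \<in> G" "p \<noteq> 0" "q = m + n"
    then obtain k where k: "(p, a, k) \<in> G" "(k, b, m) \<in> G" using GD(6) 2 by blast
    then have "k < m" "k \<noteq> 0" using GD(2)[OF k(1)] GD(2)[OF k(2)] by auto
    then show ?thesis using k l left_inner left_end by blast
  next
    fix q' assume r: "p = 0" "q = m + q'" "(0, c, q') \<in> H" "q' < n"
    then obtain k where k: "(0, a, k) \<in> H" "(k, b, q') \<in> H" using HD(6) 2 by blast
    then have "k \<noteq> n" "k \<noteq> 0" using HD(2)[OF k(1)] HD(2)[OF k(2)] r by auto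
    then show ?thesis using k r right_inner right_start by blast
  next
    fix p' q' assume r: "p = m + p'" "q = m + q'" "(p', c, q') \<in> H" "p' \<noteq> 0"
    then obtain k where k: "(p', a, k) \<in> H" "(k, b, q') \<in> H" using HD(6) 2 by blast
    then have "k \<noteq> 0" using HD(2)[OF k(1)] by auto
    then show ?thesis using k r right_inner by blast
  qed
  show ?thesis
    unfolding is_layout_def using whole bounds unique join split by blast
qed

lemma layout_exists: "\<exists>G n. is_layout G n s"
proof (induction s)
  case (Atom a)
  \<comment> \<open>One edge takes two letters, because a one-letter word equals its mirror
    image.\<close>
  have "is_layout {(0, Atom a, 2)} 2 (Atom a)"
    by (simp add: is_layout_def)
  then show ?case by blast
next
  case (Seq s t)
  then show ?case using is_layout_seq by metis
next
  case (Par s t)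
  then show ?case using is_layout_par by metis
qed


section \<open>Language semantics\<close>

definition lang_iter :: "'a list set \<Rightarrow> 'a list set" where
  "lang_iter A = (\<Union>n\<in>{1..}. lang_power A n)"

lemma conc_eq_UN: "conc A B = (\<Union>u\<in>A. \<Union>v\<in>B. {u @ v})"
  by (auto simp: conc_def)

lemma conc_assoc: "conc A (conc B C) = conc (conc A B) C"
  by (simp add: conc_eq_UN)

lemma conc_epsilon [simp]: "conc A {[]} = A" "conc {[]} A = A"
  by (simp_all add: conc_def)

lemma conc_UN: "conc A (\<Union>i\<in>I. B i) = (\<Union>i\<in>I. conc A (B i))"
  "conc (\<Union>i\<in>I. B i) A = (\<Union>i\<in>I. conc (B i) A)"
  by (auto simp: conc_def)

lemma lang_power_Suc_right: "lang_power A (Suc n) = conc (lang_power A n) A"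
  by (induction n) (simp_all add: conc_assoc)

lemma lang_iter_Suc: "lang_iter A = (\<Union>n. lang_power A (Suc n))"
proof -
  have "{1..} = range Suc"
    by (metis One_nat_def atLeast_Suc_greaterThan greaterThan_0)
  then show ?thesis by (simp add: lang_iter_def)
qed

lemma lang_iter_unfold_left: "lang_iter A = A \<union> conc A (lang_iter A)"
  and lang_iter_unfold_right: "lang_iter A = A \<union> conc (lang_iter A) A"
proof -
  have UN: "(\<Union>n. f n) = f 0 \<union> (\<Union>n. f (Suc n))" for f :: "nat \<Rightarrow> 'a list set"
    by (auto, metis not0_implies_Suc)
  have "lang_iter A = A \<union> (\<Union>n. lang_power A (Suc (Suc n)))"
    unfolding lang_iter_Suc by (subst UN) simp
  moreover have "conc A (lang_iter A) = (\<Union>n. lang_power A (Suc (Suc n)))"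
    unfolding lang_iter_Suc conc_UN by simp
  moreover have "conc (lang_iter A) A = (\<Union>n. lang_power A (Suc (Suc n)))"
    by (simp only: lang_iter_Suc conc_UN lang_power_Suc_right[symmetric])
  ultimately show "lang_iter A = A \<union> conc A (lang_iter A)" "lang_iter A = A \<union> conc (lang_iter A) A"
    by simp_all
qed

lemma rev_conc: "rev ` conc A B = conc (rev ` B) (rev ` A)"
  by (auto simp: conc_eq_UN image_UN)

lemma mem_rev_image: "w \<in> rev ` A \<longleftrightarrow> rev w \<in> A"
  by (auto intro: image_eqI[where x = "rev w"])

lemma rev_lang_iter: "rev ` lang_iter A = lang_iter (rev ` A)"
proof -
  have "rev ` lang_power A n = lang_power (rev ` A) n" for n
  proof (induction n)
    case (Suc n)
    then show ?case
      using lang_power_Suc_right[of "rev ` A" n] by (simp add: rev_conc)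
  qed simp
  then show ?thesis by (simp add: lang_iter_def image_UN)
qed

lemma lang_iter_induct:
  shows "conc A B \<subseteq> B \<Longrightarrow> conc (lang_iter A) B \<subseteq> B" "conc B A \<subseteq> B \<Longrightarrow> conc B (lang_iter A) \<subseteq> B"
proof -
  have mono: "C \<subseteq> D \<Longrightarrow> conc C E \<subseteq> conc D E" "C \<subseteq> D \<Longrightarrow> conc E C \<subseteq> conc E D" for C D E :: "'a list set"
    by (auto simp: conc_def)
  show "conc (lang_iter A) B \<subseteq> B" if "conc A B \<subseteq> B"
  proof -
    have "conc (lang_power A n) B \<subseteq> B" for n
    proof (induction n)
      case (Suc n)
      have "conc (lang_power A (Suc n)) B = conc A (conc (lang_power A n) B)"
        by (simp add: conc_assoc)
      also have "\<dots> \<subseteq> B"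
        using mono(2)[OF Suc.IH, of A] that by (rule subset_trans)
      finally show ?case .
    qed simp
    then show ?thesis by (auto simp: lang_iter_def conc_UN)
  qed
  show "conc B (lang_iter A) \<subseteq> B" if "conc B A \<subseteq> B"
  proof -
    have "conc B (lang_power A n) \<subseteq> B" for n
    proof (induction n)
      case (Suc n)
      have "conc B (lang_power A (Suc n)) = conc (conc B (lang_power A n)) A"
        by (simp add: lang_power_Suc_right conc_assoc del: lang_power.simps(2))
      also have "\<dots> \<subseteq> B"
        using mono(1)[OF Suc.IH, of A] that by (rule subset_trans)
      finally show ?case .
    qed simp
    then show ?thesis by (auto simp: lang_iter_def conc_UN)
  qed
qed

lemma sem_Iter: "sem \<sigma> (Iter e) = lang_iter (sem \<sigma> e)"
  by (simp add: lang_iter_def)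

lemma sem_sound: "e \<equiv>\<^sub>a\<^sub>x f \<Longrightarrow> sem \<sigma> e = sem \<sigma> f"
proof (induction rule: ax_equiv.induct)
  case (Iter_unfold_left e)
  then show ?case unfolding sem_Iter sem.simps(3,4) by (rule lang_iter_unfold_left)
next
  case (Iter_unfold_right e)
  then show ?case unfolding sem_Iter sem.simps(3,4) by (rule lang_iter_unfold_right)
next
  case (Mirror_Iter e)
  then show ?case unfolding sem_Iter sem.simps(7) by (rule rev_lang_iter)
next
  case (Iter_induct_left e f)
  then show ?case unfolding sem_Iter sem.simps(3,4) using lang_iter_induct(1) by blast
next
  case (Iter_induct_right f e)
  then show ?case unfolding sem_Iter sem.simps(3,4) using lang_iter_induct(2) by blast
next
  case (Conc_assoc e f g)
  then show ?case by (simp add: conc_assoc)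
next
  case (Mirror_Conc e f)
  then show ?case by (simp add: rev_conc)
next
  \<comment> \<open>Reversal preserves intersections because it is injective.\<close>
  case (Mirror_Cap e f)
  then show ?case by (simp add: image_Int)
qed (auto simp: conc_def image_Un image_image)


section \<open>Pushing mirrors to the variables\<close>

text \<open>The flag says whether a mirror is pending; if so, the factors of a concatenation are
  swapped.\<close>

primrec push_mirror :: "'x onefree \<Rightarrow> bool \<Rightarrow> 'x onefree" where
  "push_mirror (Var x) b = (if b then Mirror (Var x) else Var x)"
| "push_mirror Zero b = Zero"
| "push_mirror (Plus e f) b = Plus (push_mirror e b) (push_mirror f b)"
| "push_mirror (Conc e f) b =
    (if b then Conc (push_mirror f b) (push_mirror e b) else Conc (push_mirror e b) (push_mirror f b))"
| "push_mirror (Cap e f) b = Cap (push_mirror e b) (push_mirror f b)"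
| "push_mirror (Iter e) b = Iter (push_mirror e b)"
| "push_mirror (Mirror e) b = push_mirror e (\<not> b)"

primrec mirror_normal :: "'x onefree \<Rightarrow> bool" where
  "mirror_normal (Var x) = True"
| "mirror_normal Zero = True"
| "mirror_normal (Plus e f) = (mirror_normal e \<and> mirror_normal f)"
| "mirror_normal (Conc e f) = (mirror_normal e \<and> mirror_normal f)"
| "mirror_normal (Cap e f) = (mirror_normal e \<and> mirror_normal f)"
| "mirror_normal (Iter e) = mirror_normal e"
| "mirror_normal (Mirror e) = (e \<in> range Var)"

lemma mirror_normal_push: "mirror_normal (push_mirror e b)"
  by (induction e arbitrary: b) auto

text \<open>No axiom speaks of the mirror of zero. Mirroring \<open>Plus (Mirror Zero) Zero\<close>,
  which equals \<open>Mirror Zero\<close>, shows that adding \<open>Mirror Zero\<close> to zero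
  gives zero.\<close>

lemma ax_Mirror_Zero: "Mirror Zero \<equiv>\<^sub>a\<^sub>x (Zero :: 'x onefree)"
proof -
  have "Mirror (Plus (Mirror (Zero :: 'x onefree)) Zero) \<equiv>\<^sub>a\<^sub>x Mirror (Mirror Zero)"
    by (intro ax_equiv.cong_Mirror ax_equiv.Plus_Zero)
  moreover have "Mirror (Plus (Mirror Zero) Zero) \<equiv>\<^sub>a\<^sub>x Plus (Mirror (Mirror Zero)) (Mirror (Zero :: 'x onefree))"
    by (rule ax_equiv.Mirror_Plus)
  ultimately have "Plus (Mirror (Mirror Zero)) (Mirror (Zero :: 'x onefree)) \<equiv>\<^sub>a\<^sub>x Mirror (Mirror Zero)"
    by (meson ax_equiv.sym ax_equiv.trans)
  moreover have "cls (Mirror (Mirror Zero)) = cls (Zero :: 'x onefree)"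
    by (simp add: cls_eq_iff ax_equiv.Mirror_Mirror del: cls_simps)
  ultimately show ?thesis
    unfolding cls_eq_iff[symmetric] by simp
qed

lemma push_mirror_equiv: "(if b then Mirror e else e) \<equiv>\<^sub>a\<^sub>x push_mirror e b"
proof (induction e arbitrary: b)
  case (Var x)
  then show ?case by (simp add: ax_equiv.refl)
next
  case Zero
  then show ?case by (simp add: ax_equiv.refl ax_Mirror_Zero)
next
  case (Plus e f)
  then show ?case
    using ax_equiv.cong_Plus[OF Plus.IH[of b]] ax_equiv.trans[OF ax_equiv.Mirror_Plus] by (cases b) simp_all
next
  case (Conc e f)
  then show ?case
    using ax_equiv.cong_Conc[OF Conc.IH[of b]] ax_equiv.cong_Conc[OF Conc.IH(2,1)[of b]]
      ax_equiv.trans[OF ax_equiv.Mirror_Conc] by (cases b) simp_all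
next
  case (Cap e f)
  then show ?case
    using ax_equiv.cong_Cap[OF Cap.IH[of b]] ax_equiv.trans[OF ax_equiv.Mirror_Cap] by (cases b) simp_all
next
  case (Iter e)
  then show ?case
    using ax_equiv.cong_Iter[OF Iter.IH[of b]] ax_equiv.trans[OF ax_equiv.Mirror_Iter] by (cases b) simp_all
next
  case (Mirror e)
  then show ?case
    using Mirror.IH[of "\<not> b"] ax_equiv.trans[OF ax_equiv.Mirror_Mirror] by (cases b) simp_all
qed


section \<open>Completeness\<close>

inductive_simps forces_Var_iff: "forces s (Var x)"
inductive_simps forces_Mirror_iff: "forces s (Mirror g)"
inductive_simps forces_Zero_iff: "forces s Zero"
inductive_simps forces_Plus_iff: "forces s (Plus g h)"
inductive_simps forces_Cap_iff: "forces s (Cap g h)"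
inductive_simps forces_Conc_iff: "forces s (Conc g h)"

section \<open>Factors of words with pairwise distinct letters\<close>

lemma map_upt_inj:
  assumes "inj f" "map f [p..<q] = map f [p'..<q']" "p < q"
  shows "p = p' \<and> q = q'"
proof -
  have eq: "[p..<q] = [p'..<q']"
    using assms(1,2) by (metis inj_map_eq_map)
  then have "q - p = q' - p'" by (metis length_upt)
  moreover from this have "p = p'"
    using eq assms(3) by (metis hd_upt zero_less_diff)
  ultimately show ?thesis using assms(3) by simp
qed

text \<open>The first two positions increase on the left and decrease on the right.\<close>

lemma map_upt_neq_rev:
  assumes "inj f" "p + 2 \<le> q"
  shows "map f [p..<q] \<noteq> rev (map f [p'..<q'])"
proof
  assume "map f [p..<q] = rev (map f [p'..<q'])"
  then have eq: "[p..<q] = rev [p'..<q']"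
    using assms(1) by (metis inj_map_eq_map rev_map)
  then have len: "q - p = q' - p'" by (metis length_rev length_upt)
  have "[p..<q] ! 0 = rev [p'..<q'] ! 0" "[p..<q] ! 1 = rev [p'..<q'] ! 1"
    using eq by simp_all
  then show False
    using assms(2) len by (simp add: rev_nth)
qed

lemma map_upt_append: "p \<le> k \<Longrightarrow> k \<le> q \<Longrightarrow> map f [p..<q] = map f [p..<k] @ map f [k..<q]"
  by (metis le_Suc_ex map_append upt_add_eq_append)

lemma map_upt_eq_append:
  assumes "map f [p..<q] = u @ v" "p \<le> q"
  obtains k where "p \<le> k" "k \<le> q" "u = map f [p..<k]" "v = map f [k..<q]"
proof (rule that[of "p + length u"])
  have len: "length u \<le> q - p"
    using arg_cong[OF assms(1), of length] by simp
  show "p \<le> p + length u" by simp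
  show "p + length u \<le> q" using len assms(2) by simp
  show "u = map f [p..<p + length u]"
    using arg_cong[OF assms(1), of "take (length u)"] len assms(2) by (simp add: take_map)
  show "v = map f [p + length u..<q]"
    using arg_cong[OF assms(1), of "drop (length u)"] by (simp add: drop_map)
qed

context
  fixes G :: "(nat \<times> 'x sp \<times> nat) set" and n :: nat and s :: "'x sp" and letter :: "nat \<Rightarrow> 'a"
  assumes layout: "is_layout G n s" and inj: "inj letter"
begin

text \<open>An edge labelled by a mirrored variable puts the reversed factor into the language, so
  that the mirror of the language contains the factor itself.\<close>

definition layout_lang :: "'x \<Rightarrow> 'a list set" where
  "layout_lang x = {map letter [p..<q] | p c q. (p, c, q) \<in> G \<and> Var x \<in> atoms c} \<union>
    {rev (map letter [p..<q]) | p c q. (p, c, q) \<in> G \<and> Mirror (Var x) \<in> atoms c}"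

text \<open>A factor from the layout determines its ends and is not the reverse of any factor, so
  the two halves of \<open>layout_lang\<close> do not interfere.\<close>

lemma factor_in_layout_lang:
  assumes "p \<le> q"
  shows "map letter [p..<q] \<in> layout_lang x \<longleftrightarrow> (\<exists>c. (p, c, q) \<in> G \<and> Var x \<in> atoms c)"
    and "rev (map letter [p..<q]) \<in> layout_lang x \<longleftrightarrow> (\<exists>c. (p, c, q) \<in> G \<and> Mirror (Var x) \<in> atoms c)"
proof -
  have factor: "p = p' \<and> q = q'" if "(p', c, q') \<in> G" "map letter [p..<q] = map letter [p'..<q']" for p' c q'
    using map_upt_inj[OF inj that(2)[symmetric]] is_layoutD(2)[OF layout that(1)] by simp
  have mirrored: "map letter [p..<q] \<noteq> rev (map letter [p'..<q'])" if "(p', c, q') \<in> G" for p' c q'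
    using map_upt_neq_rev[OF inj is_layoutD(2)[OF layout that], of p q] by (metis rev_rev_ident)
  show "map letter [p..<q] \<in> layout_lang x \<longleftrightarrow> (\<exists>c. (p, c, q) \<in> G \<and> Var x \<in> atoms c)"
    unfolding layout_lang_def using factor mirrored by blast
  have "rev (map letter [p..<q]) \<noteq> map letter [p'..<q']" if "(p', c, q') \<in> G" for p' c q'
    using mirrored[OF that] by (metis rev_rev_ident)
  moreover have "p = p' \<and> q = q'" if "(p', c, q') \<in> G" "rev (map letter [p..<q]) = rev (map letter [p'..<q'])"
    for p' c q'
    using factor that by (metis rev_rev_ident)
  ultimately show "rev (map letter [p..<q]) \<in> layout_lang x \<longleftrightarrow> (\<exists>c. (p, c, q) \<in> G \<and> Mirror (Var x) \<in> atoms c)"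
    unfolding layout_lang_def by blast
qed

text \<open>Cutting a factor into two factors of the layout corresponds to splitting its graph at an
  inner node; this gives concatenation and iteration.\<close>

lemma factor_in_sem_iff:
  assumes "mirror_normal g" "p \<le> q"
  shows "map letter [p..<q] \<in> sem layout_lang g \<longleftrightarrow> (\<exists>c. (p, c, q) \<in> G \<and> forces c g)"
  using assms
proof (induction g arbitrary: p q)
  case (Var x)
  then show ?case by (simp add: factor_in_layout_lang forces_Var_iff)
next
  case Zero
  then show ?case by (simp add: forces_Zero_iff)
next
  case (Plus g h)
  then show ?case by (auto simp: forces_Plus_iff)
next
  case (Cap g h)
  \<comment> \<open>Both conjuncts concern the same graph, since a layout has at most one between
    given ends.\<close>
  have "(\<exists>c. (p, c, q) \<in> G \<and> forces c g) \<and> (\<exists>c. (p, c, q) \<in> G \<and> forces c h) \<longleftrightarrow>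
      (\<exists>c. (p, c, q) \<in> G \<and> forces c g \<and> forces c h)"
    using is_layoutD(4)[OF layout] by metis
  then show ?case using Cap by (simp add: forces_Cap_iff)
next
  case (Mirror g)
  then obtain x where g: "g = Var x" by auto
  have "map letter [p..<q] \<in> sem layout_lang (Mirror g) \<longleftrightarrow> rev (map letter [p..<q]) \<in> layout_lang x"
    by (simp only: g sem.simps mem_rev_image)
  then show ?case
    using factor_in_layout_lang(2)[OF Mirror.prems(2), of x] g by (simp only: forces_Mirror_iff)
next
  case (Conc g h)
  have IHg: "map letter [p..<q] \<in> sem layout_lang g \<longleftrightarrow> (\<exists>c. (p, c, q) \<in> G \<and> forces c g)"
    and IHh: "map letter [p..<q] \<in> sem layout_lang h \<longleftrightarrow> (\<exists>c. (p, c, q) \<in> G \<and> forces c h)"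
    if "p \<le> q" for p q
    using Conc.IH that Conc.prems(1) by simp_all
  show ?case
  proof
    assume "map letter [p..<q] \<in> sem layout_lang (Conc g h)"
    then obtain u v where uv: "map letter [p..<q] = u @ v" "u \<in> sem layout_lang g" "v \<in> sem layout_lang h"
      by (auto simp: conc_def)
    obtain k where k: "p \<le> k" "k \<le> q" "u = map letter [p..<k]" "v = map letter [k..<q]"
      using map_upt_eq_append[OF uv(1) Conc.prems(2)] by blast
    then obtain a b where ab: "(p, a, k) \<in> G" "forces a g" "(k, b, q) \<in> G" "forces b h"
      using IHg[OF k(1)] IHh[OF k(2)] uv by blast
    then show "\<exists>c. (p, c, q) \<in> G \<and> forces c (Conc g h)"
      using is_layoutD(5)[OF layout ab(1,3)] by (auto intro: forces.Conc)
  next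
    assume "\<exists>c. (p, c, q) \<in> G \<and> forces c (Conc g h)"
    then obtain c a b where c: "(p, c, q) \<in> G" "(a, b) \<in> splits c" "forces a g" "forces b h"
      by (auto simp: forces_Conc_iff)
    then obtain k where k: "(p, a, k) \<in> G" "(k, b, q) \<in> G"
      using is_layoutD(6)[OF layout] by blast
    then have pkq: "p \<le> k" "k \<le> q"
      using is_layoutD(2)[OF layout k(1)] is_layoutD(2)[OF layout k(2)] by auto
    have "map letter [p..<q] = map letter [p..<k] @ map letter [k..<q]"
      using pkq by (rule map_upt_append)
    moreover have "map letter [p..<k] \<in> sem layout_lang g" "map letter [k..<q] \<in> sem layout_lang h"
      using IHg[OF pkq(1)] IHh[OF pkq(2)] c k by blast+
    ultimately show "map letter [p..<q] \<in> sem layout_lang (Conc g h)"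
      unfolding sem.simps conc_def by blast
  qed
next
  case (Iter g)
  then have IH: "p \<le> q \<Longrightarrow> map letter [p..<q] \<in> sem layout_lang g \<longleftrightarrow> (\<exists>c. (p, c, q) \<in> G \<and> forces c g)" for p q
    by simp
  \<comment> \<open>Only positive powers occur, so the base case is a single word of the language of
    \<open>g\<close>.\<close>
  have 1: "\<exists>c. (p, c, q) \<in> G \<and> forces c (Iter g)"
    if "map letter [p..<q] \<in> lang_power (sem layout_lang g) (Suc i)" "p \<le> q" for i p q
    using that
  proof (induction i arbitrary: p q)
    case 0
    then show ?case using IH by (auto intro: forces.Iter1)
  next
    case (Suc i)
    then obtain u v where uv: "map letter [p..<q] = u @ v" "u \<in> sem layout_lang g"
      "v \<in> lang_power (sem layout_lang g) (Suc i)"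
      unfolding lang_power.simps(2)[of _ "Suc i"] conc_def by blast
    obtain k where k: "p \<le> k" "k \<le> q" "u = map letter [p..<k]" "v = map letter [k..<q]"
      using map_upt_eq_append[OF uv(1) Suc.prems(2)] by blast
    then obtain a b where ab: "(p, a, k) \<in> G" "forces a g" "(k, b, q) \<in> G" "forces b (Iter g)"
      using IH[OF k(1)] Suc.IH[OF _ k(2)] uv by blast
    then show ?case
      using is_layoutD(5)[OF layout ab(1,3)] by (auto intro: forces.Iter2)
  qed
  have 2: "map letter [p..<q] \<in> lang_iter (sem layout_lang g)"
    if "forces c (Iter g)" "(p, c, q) \<in> G" "p \<le> q" for c p q
    using that
  proof (induction c "Iter g" arbitrary: p q rule: forces.induct)
    case (Iter1 c)
    then show ?case using IH lang_iter_unfold_left by blast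
  next
    case (Iter2 a b c)
    then obtain k where k: "(p, a, k) \<in> G" "(k, b, q) \<in> G"
      using is_layoutD(6)[OF layout] by blast
    then have pkq: "p \<le> k" "k \<le> q"
      using is_layoutD(2)[OF layout k(1)] is_layoutD(2)[OF layout k(2)] by auto
    then have "map letter [p..<q] = map letter [p..<k] @ map letter [k..<q]"
      by (rule map_upt_append)
    moreover have "map letter [p..<k] \<in> sem layout_lang g" "map letter [k..<q] \<in> lang_iter (sem layout_lang g)"
      using IH[OF pkq(1)] k Iter2 pkq by blast+
    ultimately have "map letter [p..<q] \<in> conc (sem layout_lang g) (lang_iter (sem layout_lang g))"
      unfolding conc_def by blast
    then show ?case using lang_iter_unfold_left by blast
  qed
  show ?case
    using 1[of p q] 2[of _ p q] Iter.prems(2) unfolding sem_Iter lang_iter_Suc by blast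
qed

lemma layout_word_in_sem_iff:
  assumes "mirror_normal g"
  shows "map letter [0..<n] \<in> sem layout_lang g \<longleftrightarrow> forces s g"
proof -
  have "c = s" if "(0, c, n) \<in> G" for c
    using is_layoutD(4)[OF layout that is_layoutD(1)[OF layout]] .
  then show ?thesis
    unfolding factor_in_sem_iff[OF assms le0] using is_layoutD(1)[OF layout] by blast
qed

end

text \<open>The word laid out for a term of \<open>e\<close> lies in the language of
  \<open>e\<close>, hence in that of \<open>f\<close>, so \<open>f\<close> covers the term.\<close>

lemma lang_le_imp_cls_le:
  fixes e f :: "'x onefree"
  assumes inf: "infinite (UNIV :: 'a set)" and normal: "mirror_normal e" "mirror_normal f"
    and le: "\<And>\<sigma> :: 'x \<Rightarrow> 'a list set. sem \<sigma> e \<subseteq> sem \<sigma> f"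
  shows "cls e \<le> cls f"
proof (rule forces_complete)
  fix s assume "s \<in> terms e"
  then have "forces s e" by (rule forces_terms)
  \<comment> \<open>An infinite alphabet provides a different letter for each position, however long
    the word.\<close>
  obtain letter :: "nat \<Rightarrow> 'a" where letter: "inj letter"
    using infinite_countable_subset[OF inf] by blast
  obtain G n where G: "is_layout G n s"
    using layout_exists by blast
  note iff = layout_word_in_sem_iff[OF G letter]
  have "map letter [0..<n] \<in> sem (layout_lang G letter) e"
    using \<open>forces s e\<close> iff[OF normal(1)] by simp
  then show "forces s f"
    using le iff[OF normal(2)] by blast
qed

theorem theorem9:
  fixes e f :: "'x onefree"
  assumes "infinite (UNIV :: 'a set)"
  shows "e \<equiv>\<^sub>a\<^sub>x f \<longleftrightarrow> lang_equiv TYPE('a) e f"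
proof
  assume "e \<equiv>\<^sub>a\<^sub>x f"
  then show "lang_equiv TYPE('a) e f"
    by (simp add: lang_equiv_def sem_sound)
next
  assume "lang_equiv TYPE('a) e f"
  then have sem: "sem \<sigma> e = sem \<sigma> f" for \<sigma> :: "'x \<Rightarrow> 'a list set"
    unfolding lang_equiv_def by (metis lists_UNIV subset_UNIV)
  \<comment> \<open>Layouts interpret mirrors on variables only, hence the passage to provably equal
    normal forms.\<close>
  let ?e = "push_mirror e False" and ?f = "push_mirror f False"
  have equiv: "e \<equiv>\<^sub>a\<^sub>x ?e" "f \<equiv>\<^sub>a\<^sub>x ?f"
    using push_mirror_equiv[of False] by simp_all
  then have sem': "sem \<sigma> ?e = sem \<sigma> ?f" for \<sigma> :: "'x \<Rightarrow> 'a list set"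
    using sem[of \<sigma>] sem_sound[of e ?e \<sigma>] sem_sound[of f ?f \<sigma>] by simp
  have "cls ?e = cls ?f"
  proof (rule antisym)
    show "cls ?e \<le> cls ?f"
      using assms mirror_normal_push mirror_normal_push by (rule lang_le_imp_cls_le) (simp add: sem')
    show "cls ?f \<le> cls ?e"
      using assms mirror_normal_push mirror_normal_push by (rule lang_le_imp_cls_le) (simp add: sem')
  qed
  with equiv show "e \<equiv>\<^sub>a\<^sub>x f"
    unfolding cls_eq_iff[symmetric] by simp
qed

end
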